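(* For every tree $T$ and every integer $k>1$, there is a subdivision $T'$ of $T$ with $\zeta_k(T')=1$.
   Context: Trees are finite. A subdivision of a graph is obtained by replacing each edge by a path between its endpoints with some (possibly zero, possibly different for different edges) number of new internal vertices. The $k$-visibility Localization game on a finite connected graph $G$ ($k\ge 0$ an integer) with $m$ cops: the robber first chooses a vertex of $G$. Then in each round the cops choose any vertices $u_1,\dots,u_m$ (no restriction relative to earlier placements), and cop $i$ receives the probe $d_i=d(u_i,x)$ if the robber's vertex $x$ satisfies $d(u_i,x)\le k$, and $d_i=\ast$ (no information) otherwise; afterwards the robber moves to a neighboring vertex or stays in place. A candidate is a vertex the robber may occupy, consistent with the information obtained so far. The cops win if they have a strategy that, whatever the robber does, determines after finitely many rounds a unique candidate (the robber is omniscient and knows the cops' entire strategy). The $k$-visibility localization number $\zeta_k(G)$ is the least positive integer $m$ for which $m$ cops have a winning strategy. *)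

theory Defs
  imports "Graph_Theory.Graph_Theory"
begin

text \<open>
  Finite simple graphs are the symmetric loop-free digraphs of locale \<^locale>\<open>pair_graph\<close>:
  an undirected edge is a pair of opposite arcs. Its arcs \<open>(u, v), (v, u)\<close> form a
  cycle in the sense of \<^const>\<open>pre_digraph.cycle\<close>, so \<^const>\<open>forest\<close> and \<^const>\<open>tree\<close>
  are not the undirected notions; the cycles of the undirected graph are those of length at least 3.
\<close>

definition undirected_tree :: "'a pair_pre_digraph \<Rightarrow> bool" where
  "undirected_tree T \<longleftrightarrow>
     pair_graph T \<and> Digraph_Component.connected (with_proj T) \<and>
     \<not> (\<exists>p. pre_digraph.cycle (with_proj T) p \<and> length p \<ge> 3)"

text \<open>
  \<^const>\<open>subdivision_pair\<close> keeps the vertices of the original graph and adds new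
  ones of the same type, which need not have any to spare. Hence the graph is first copied along
  \<^const>\<open>Inl\<close> to a type with infinitely many further elements.
\<close>

definition copy_graph :: "'a pair_pre_digraph \<Rightarrow> ('a + nat) pair_pre_digraph" where
  "copy_graph G = \<lparr> pverts = Inl ` pverts G, parcs = map_prod Inl Inl ` parcs G \<rparr>"

definition is_subdivision_of ::
    "('a + nat) pair_pre_digraph \<Rightarrow> 'a pair_pre_digraph \<Rightarrow> bool" where
  "is_subdivision_of H G \<longleftrightarrow> subdivision_pair (copy_graph G) H"

definition graph_dist :: "'a pair_pre_digraph \<Rightarrow> 'a \<Rightarrow> 'a \<Rightarrow> ereal" where
  "graph_dist G u v = wf_digraph.\<mu> (with_proj G) (\<lambda>_. 1) u v"

text \<open>A probe that yields no information is \<^const>\<open>None\<close>.\<close>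

type_synonym probe = "ereal option"

definition probe :: "nat \<Rightarrow> 'a pair_pre_digraph \<Rightarrow> 'a \<Rightarrow> 'a \<Rightarrow> probe" where
  "probe k G u x = (if graph_dist G u x \<le> ereal (real k) then Some (graph_dist G u x) else None)"

text \<open>
  A strategy maps the probe results of all previous rounds (one list per round, one entry per
  cop, oldest round first) to the next placement of the cops. The earlier placements are
  themselves determined by these results. Several cops may share a vertex.
\<close>

type_synonym 'a strategy = "probe list list \<Rightarrow> 'a list"

definition cop_strategy :: "nat \<Rightarrow> 'a pair_pre_digraph \<Rightarrow> 'a strategy \<Rightarrow> bool" where
  "cop_strategy m G \<sigma> \<longleftrightarrow> (\<forall>h. length (\<sigma> h) = m \<and> set (\<sigma> h) \<subseteq> pverts G)"

text \<open>The robber is at \<open>x n\<close> when the cops probe for the \<open>(n + 1)\<close>-st time.\<close>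

definition robber_walk :: "'a pair_pre_digraph \<Rightarrow> (nat \<Rightarrow> 'a) \<Rightarrow> bool" where
  "robber_walk G x \<longleftrightarrow>
     x 0 \<in> pverts G \<and> (\<forall>n. x (Suc n) = x n \<or> (x n, x (Suc n)) \<in> parcs G)"

primrec history ::
    "nat \<Rightarrow> 'a pair_pre_digraph \<Rightarrow> 'a strategy \<Rightarrow> (nat \<Rightarrow> 'a) \<Rightarrow> nat \<Rightarrow> probe list list" where
  "history k G \<sigma> x 0 = []"
| "history k G \<sigma> x (Suc n) =
     history k G \<sigma> x n @ [map (\<lambda>u. probe k G u (x n)) (\<sigma> (history k G \<sigma> x n))]"

text \<open>
  The candidates right after the \<open>(n + 1)\<close>-st probe, before the robber moves again,
  if the actual walk of the robber is \<open>x\<close>.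
\<close>

definition candidates ::
    "nat \<Rightarrow> 'a pair_pre_digraph \<Rightarrow> 'a strategy \<Rightarrow> (nat \<Rightarrow> 'a) \<Rightarrow> nat \<Rightarrow> 'a set" where
  "candidates k G \<sigma> x n =
     {y n | y. robber_walk G y \<and> history k G \<sigma> y (Suc n) = history k G \<sigma> x (Suc n)}"

definition cops_win :: "nat \<Rightarrow> 'a pair_pre_digraph \<Rightarrow> nat \<Rightarrow> bool" where
  "cops_win k G m \<longleftrightarrow>
     (\<exists>\<sigma>. cop_strategy m G \<sigma> \<and>
       (\<forall>x. robber_walk G x \<longrightarrow> (\<exists>n v. candidates k G \<sigma> x n = {v})))"

definition visibility_localization_number :: "nat \<Rightarrow> 'a pair_pre_digraph \<Rightarrow> nat" where
  "visibility_localization_number k G = (LEAST m. m > 0 \<and> cops_win k G m)"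

end

theory Submission
  imports Defs
begin

text \<open>
  Subdivide the edges of the rooted tree so that a path to a parent is far longer than any path
  further on in a fixed numbering of the vertices by which parents precede children. The cop only
  needs the answers 0, 1, 2 and ``more than 2''. Probing a branch vertex \<open>v\<close> in every other round
  costs nothing: if the answer reveals that the robber is next to \<open>v\<close>, the cop wins locally, since
  he can rule out one leg at \<open>v\<close>, guard \<open>v\<close> from there, and clear the remaining legs one by one.
  With \<open>v\<close> guarded, the remaining rounds push the robber back along a leg from its outer end. So
  the subtrees are cleared from the leaves to the root: below \<open>v\<close>, child by child, where the legs
  that get contaminated again meanwhile are long enough to stop the robber until \<open>v\<close> is guarded.
\<close>

section \<open>The game with four answers\<close>

text \<open>The obstacle is that an answer 1 or 2 at a branch vertex \<open>v\<close> tells a depth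
  but no leg. A rhythm of two rounds makes guarding work: after an uneventful guarding probe the
  robber is at distance at least 2, so he can be back at \<open>v\<close> only after two moves, just
  when \<open>v\<close> is guarded again. No clear leg is entered in between, and the other round is
  free for the end of a contaminated leg. That contamination shrinks by at least 1 in two rounds, so
  depth M vanishes within 2 * M rounds, while another leg contaminated up to M reaches at most 3 *
  M; hence the powers of 3. The 4 is the depth possible when the local win starts: seen at distance
  2, one move, one probe, one move. Claims about phases have the form: \<open>S\<close> is winning
  if every set that can be reached from it in a stated number of rounds and obeys a stated bound is
  winning. They compose without explicit strategies, and the number of rounds limits what happens on
  uncontrolled legs.\<close>

definition near :: "('v \<times> 'v) set \<Rightarrow> 'v \<Rightarrow> 'v \<Rightarrow> nat" where
  "near E u x =
     (if x = u then 0 else if (u, x) \<in> E then 1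
      else if \<exists>w. (u, w) \<in> E \<and> (w, x) \<in> E then 2 else 3)"

definition nbhd :: "('v \<times> 'v) set \<Rightarrow> 'v set \<Rightarrow> 'v set" where
  "nbhd E S = S \<union> E `` S"

text \<open>
  A set is winning if a single cop who only distinguishes the distances 0, 1, 2 and more
  locates a robber known to be in this set right before the next probe.
\<close>

inductive winning :: "'v set \<Rightarrow> ('v \<times> 'v) set \<Rightarrow> 'v set \<Rightarrow> bool" for V E where
  probing: "u \<in> V \<Longrightarrow>
    (\<And>r. (\<exists>w. {x \<in> S. near E u x = r} \<subseteq> {w}) \<or> winning V E (nbhd E {x \<in> S. near E u x = r}))
    \<Longrightarrow> winning V E S"

lemma nbhd_mono: "S \<subseteq> S' \<Longrightarrow> nbhd E S \<subseteq> nbhd E S'"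
  unfolding nbhd_def by blast

lemma winning_mono: "winning V E S \<Longrightarrow> S' \<subseteq> S \<Longrightarrow> winning V E S'"
proof (induction arbitrary: S' rule: winning.induct)
  case (probing u S)
  show ?case
  proof (rule winning.probing[OF probing.hyps(1)])
    fix r
    have "{x \<in> S'. near E u x = r} \<subseteq> {x \<in> S. near E u x = r}"
      using probing.prems by blast
    then show "(\<exists>w. {x \<in> S'. near E u x = r} \<subseteq> {w})
        \<or> winning V E (nbhd E {x \<in> S'. near E u x = r})"
      using probing.IH[of r] nbhd_mono[of _ _ E] by (meson subset_trans)
  qed
qed

text \<open>The win is proved on pairs of numbers and has to be carried over to the vertex type of
  the subdivision.\<close>

lemma winning_image:
  assumes "winning V E S" "inj_on \<phi> V" "E \<subseteq> V \<times> V" "S \<subseteq> V"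
  shows "winning (\<phi> ` V) (map_prod \<phi> \<phi> ` E) (\<phi> ` S)"
  using assms(1,4)
proof (induction rule: winning.induct)
  case (probing u S)
  have near: "near (map_prod \<phi> \<phi> ` E) (\<phi> u) (\<phi> x) = near E u x" if "x \<in> V" for x
  proof -
    have *: "(\<phi> a, \<phi> b) \<in> map_prod \<phi> \<phi> ` E \<longleftrightarrow> (a, b) \<in> E" if "a \<in> V" "b \<in> V" for a b
    proof
      assume "(\<phi> a, \<phi> b) \<in> map_prod \<phi> \<phi> ` E"
      then obtain c d where "(c, d) \<in> E" "\<phi> a = \<phi> c" "\<phi> b = \<phi> d" by (elim imageE) auto
      moreover from this have "a = c" "b = d"
        using that assms(3) inj_onD[OF assms(2)] by blast+
      ultimately show "(a, b) \<in> E" by simp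
    qed force
    have "(\<exists>w. (\<phi> u, w) \<in> map_prod \<phi> \<phi> ` E \<and> (w, \<phi> x) \<in> map_prod \<phi> \<phi> ` E)
        \<longleftrightarrow> (\<exists>w. (u, w) \<in> E \<and> (w, x) \<in> E)" (is "?L \<longleftrightarrow> ?R")
    proof
      assume ?L
      then obtain w where w: "(\<phi> u, w) \<in> map_prod \<phi> \<phi> ` E" "(w, \<phi> x) \<in> map_prod \<phi> \<phi> ` E"
        by (elim exE conjE)
      from w(1) obtain c d where "(c, d) \<in> E" "w = \<phi> d" by (elim imageE) auto
      moreover from this have "d \<in> V" using assms(3) by (meson mem_Sigma_iff subsetD)
      ultimately have "(u, d) \<in> E" "(d, x) \<in> E"
        using w *[OF probing.hyps(1)] *[OF _ that] by simp_all
      then show ?R by (intro exI conjI)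
    next
      assume ?R
      then obtain w where "(u, w) \<in> E" "(w, x) \<in> E" by (elim exE conjE)
      then show ?L by (intro exI[of _ "\<phi> w"] conjI) (force intro: rev_image_eqI)+
    qed
    then show ?thesis
      unfolding near_def using *[OF probing.hyps(1) that] inj_on_eq_iff[OF assms(2) that probing.hyps(1)]
      by simp
  qed
  show ?case
  proof (rule winning.probing)
    fix r
    have eq: "{y \<in> \<phi> ` S. near (map_prod \<phi> \<phi> ` E) (\<phi> u) y = r} = \<phi> ` {x \<in> S. near E u x = r}"
      using near probing.prems by auto
    have "nbhd (map_prod \<phi> \<phi> ` E) (\<phi> ` X) = \<phi> ` nbhd E X" if "X \<subseteq> V" for X
    proof -
      have "(map_prod \<phi> \<phi> ` E) `` (\<phi> ` X) = \<phi> ` (E `` X)"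
      proof
        show "(map_prod \<phi> \<phi> ` E) `` (\<phi> ` X) \<subseteq> \<phi> ` (E `` X)"
        proof
          fix y assume "y \<in> (map_prod \<phi> \<phi> ` E) `` (\<phi> ` X)"
          then obtain x c d where x: "x \<in> X" "(c, d) \<in> E" "\<phi> x = \<phi> c" "y = \<phi> d" by auto
          then have "x = c" using that assms(3) inj_onD[OF assms(2)] by blast
          then show "y \<in> \<phi> ` (E `` X)" using x by blast
        qed
      qed force
      then show ?thesis by (simp add: nbhd_def image_Un)
    qed
    moreover have "{x \<in> S. near E u x = r} \<subseteq> V" "nbhd E {x \<in> S. near E u x = r} \<subseteq> V"
      using probing.prems assms(3) by (auto simp: nbhd_def)
    ultimately show "(\<exists>w. {y \<in> \<phi> ` S. near (map_prod \<phi> \<phi> ` E) (\<phi> u) y = r} \<subseteq> {w})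
        \<or> winning (\<phi> ` V) (map_prod \<phi> \<phi> ` E)
            (nbhd (map_prod \<phi> \<phi> ` E) {y \<in> \<phi> ` S. near (map_prod \<phi> \<phi> ` E) (\<phi> u) y = r})"
      unfolding eq using probing.IH[of r] by auto
  qed (use probing.hyps in blast)
qed

primrec answers ::
    "('v \<times> 'v) set \<Rightarrow> (nat list \<Rightarrow> 'v) \<Rightarrow> (nat \<Rightarrow> 'v) \<Rightarrow> nat \<Rightarrow> nat list" where
  "answers E \<tau> y 0 = []"
| "answers E \<tau> y (Suc n) = answers E \<tau> y n @ [near E (\<tau> (answers E \<tau> y n)) (y n)]"

text \<open>Answers are appended at the end, but induction on \<open>winning\<close> removes the
  first round.\<close>

lemma answers_Suc_shift:
  "answers E \<tau> y (Suc n) =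
     near E (\<tau> []) (y 0) # answers E (\<lambda>h. \<tau> (near E (\<tau> []) (y 0) # h)) (\<lambda>n. y (Suc n)) n"
proof (induction n)
  case (Suc n)
  show ?case by (subst answers.simps(2)) (simp only: Suc, simp)
qed simp

text \<open>The first answer selects one of the strategies supplied by the induction.
  Well-foundedness of \<open>winning\<close> yields a round \<open>n\<close> for each walk, without
  a bound common to all walks.\<close>

lemma winning_strategy:
  assumes "winning V E S"
  shows "\<exists>\<tau>. range \<tau> \<subseteq> V \<and>
    (\<forall>x. x 0 \<in> S \<and> (\<forall>n. x (Suc n) \<in> nbhd E {x n}) \<longrightarrow>
      (\<exists>n. \<forall>y. y 0 \<in> S \<and> (\<forall>n. y (Suc n) \<in> nbhd E {y n}) \<and>
         answers E \<tau> y (Suc n) = answers E \<tau> x (Suc n) \<longrightarrow> y n = x n))"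
  using assms
proof (induction rule: winning.induct)
  case (probing u S)
  define walk where "walk S x \<longleftrightarrow> x 0 \<in> S \<and> (\<forall>n. x (Suc n) \<in> nbhd E {x n})"
    for S :: "'a set" and x
  define wins where "wins S \<tau> \<longleftrightarrow> range \<tau> \<subseteq> V \<and> (\<forall>x. walk S x \<longrightarrow>
      (\<exists>n. \<forall>y. walk S y \<and> answers E \<tau> y (Suc n) = answers E \<tau> x (Suc n) \<longrightarrow> y n = x n))"
    for S \<tau>
  define C where "C r = {x \<in> S. near E u x = r}" for r
  have "\<exists>\<tau>. range \<tau> \<subseteq> V \<and> ((\<exists>w. C r \<subseteq> {w}) \<or> wins (nbhd E (C r)) \<tau>)" for r
  proof (cases "\<exists>w. C r \<subseteq> {w}")
    case True
    then show ?thesis using probing.hyps(1) by (intro exI[of _ "\<lambda>_. u"]) auto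
  next
    case False
    then have "\<exists>\<tau>. wins (nbhd E (C r)) \<tau>"
      using probing.IH[of r] unfolding C_def wins_def walk_def by simp
    then show ?thesis unfolding wins_def by blast
  qed
  then obtain \<rho> where \<rho>: "range (\<rho> r) \<subseteq> V" "(\<exists>w. C r \<subseteq> {w}) \<or> wins (nbhd E (C r)) (\<rho> r)" for r
    by metis
  define \<tau> where "\<tau> h = (case h of [] \<Rightarrow> u | r # h' \<Rightarrow> \<rho> r h')" for h
  have shift: "answers E \<tau> y (Suc n) =
      near E u (y 0) # answers E (\<rho> (near E u (y 0))) (\<lambda>n. y (Suc n)) n" for y n
    unfolding answers_Suc_shift by (simp add: \<tau>_def)
  have "wins S \<tau>"
    unfolding wins_def
  proof (intro conjI allI impI)
    have "\<rho> r h \<in> V" for r h using \<rho>(1) by blast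
    then show "range \<tau> \<subseteq> V"
      using probing.hyps(1) by (auto simp: \<tau>_def split: list.splits)
    fix x assume x: "walk S x"
    let ?r = "near E u (x 0)"
    have in_C: "y 0 \<in> C ?r" if "walk S y" "answers E \<tau> y (Suc n) = answers E \<tau> x (Suc n)" for y n
      using that unfolding shift by (simp add: C_def walk_def)
    show "\<exists>n. \<forall>y. walk S y \<and> answers E \<tau> y (Suc n) = answers E \<tau> x (Suc n) \<longrightarrow> y n = x n"
    proof (cases "\<exists>w. C ?r \<subseteq> {w}")
      case True
      then show ?thesis using in_C x by blast
    next
      case False
      have tail: "walk (nbhd E (C ?r)) (\<lambda>n. y (Suc n))" if "walk S y" "y 0 \<in> C ?r" for y
      proof -
        have "nbhd E {y 0} \<subseteq> nbhd E (C ?r)" using that(2) by (intro nbhd_mono) simp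
        then show ?thesis using that(1) unfolding walk_def by (meson subsetD)
      qed
      have "wins (nbhd E (C ?r)) (\<rho> ?r)" using \<rho>(2)[of ?r] False by simp
      then have "\<forall>x. walk (nbhd E (C ?r)) x \<longrightarrow> (\<exists>n. \<forall>y. walk (nbhd E (C ?r)) y \<and>
          answers E (\<rho> ?r) y (Suc n) = answers E (\<rho> ?r) x (Suc n) \<longrightarrow> y n = x n)"
        unfolding wins_def by (rule conjunct2)
      from this[rule_format, OF tail[OF x in_C[OF x refl]]]
      obtain n where n: "\<forall>y. walk (nbhd E (C ?r)) y \<and>
          answers E (\<rho> ?r) y (Suc n) = answers E (\<rho> ?r) (\<lambda>n. x (Suc n)) (Suc n) \<longrightarrow> y n = x (Suc n)"
        by (elim exE)
      have "y (Suc n) = x (Suc n)"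
        if y: "walk S y" "answers E \<tau> y (Suc (Suc n)) = answers E \<tau> x (Suc (Suc n))" for y
        using n[rule_format, of "\<lambda>n. y (Suc n)"] tail[OF y(1) in_C[OF y]] in_C[OF y] y(2)
        unfolding shift[of _ "Suc n"] C_def by (simp del: answers.simps)
      then show ?thesis by blast
    qed
  qed
  then show ?case unfolding wins_def walk_def conj_assoc by (rule exI[of _ \<tau>])
qed

section \<open>From distance probes to the four answers\<close>

definition coarse :: "probe \<Rightarrow> nat" where
  "coarse p = (if p = Some 0 then 0 else if p = Some 1 then 1 else if p = Some 2 then 2 else 3)"

context pair_wf_digraph
begin

lemma graph_dist_le: "awalk u p x \<Longrightarrow> graph_dist G u x \<le> ereal (length p)"
  unfolding graph_dist_def \<mu>_def
  by (rule INF_lower2[of p]) (simp_all add: awalk_cost_def sum_list_triv)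

text \<open>Lengths are natural numbers: some walk is shorter than \<open>n + 1\<close>, and none is
  shorter than \<open>n\<close>.\<close>

lemma graph_dist_attained:
  assumes "graph_dist G u x = ereal (real n)"
  obtains p where "awalk u p x" "length p = n"
proof -
  have eq: "graph_dist G u x = (INF p\<in>{p. awalk u p x}. ereal (real (length p)))"
    unfolding graph_dist_def \<mu>_def by (simp add: awalk_cost_def sum_list_triv)
  have "(INF p\<in>{p. awalk u p x}. ereal (real (length p))) < ereal (real (Suc n))"
    using assms eq by simp
  then obtain p where p: "awalk u p x" "length p < Suc n"
    unfolding INF_less_iff by auto
  moreover have "n \<le> length p"
    using graph_dist_le[OF p(1)] assms by simp
  ultimately show ?thesis using that by force
qed

lemma graph_dist_ge:
  assumes "\<And>p. awalk u p x \<Longrightarrow> n \<le> length p"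
  shows "ereal (real n) \<le> graph_dist G u x"
  unfolding graph_dist_def \<mu>_def
  by (rule INF_greatest) (use assms in \<open>simp add: awalk_cost_def sum_list_triv\<close>)

text \<open>Distances 0, 1 and 2 are visible because \<open>2 \<le> k\<close>. Larger visible
  distances and the answer \<open>None\<close> both become 3, so the result no longer depends on
  \<open>k\<close>.\<close>

lemma coarse_probe:
  assumes "2 \<le> k" "u \<in> pverts G"
  shows "coarse (probe k G u x) = near (parcs G) u x"
proof -
  have walk0: "awalk u [] y \<longleftrightarrow> y = u" for y
    using assms(2) by (auto simp: awalk_Nil_iff)
  have walk1: "(\<exists>p. awalk u p y \<and> length p = 1) \<longleftrightarrow> (u, y) \<in> parcs G" for y
  proof
    assume "(u, y) \<in> parcs G"
    then have "awalk u [(u, y)] y" using arc_implies_awalk[of "(u, y)"] by simp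
    then show "\<exists>p. awalk u p y \<and> length p = 1" by (intro exI[of _ "[(u, y)]"]) simp
  qed (auto simp: length_Suc_conv awalk_simps)
  have walk2: "(\<exists>p. awalk u p y \<and> length p = 2) \<longleftrightarrow> (\<exists>w. (u, w) \<in> parcs G \<and> (w, y) \<in> parcs G)" for y
  proof
    assume "\<exists>w. (u, w) \<in> parcs G \<and> (w, y) \<in> parcs G"
    then obtain w where "(u, w) \<in> parcs G" "(w, y) \<in> parcs G" by blast
    then have "awalk u [(u, w), (w, y)] y" using in_arcsD1 in_arcsD2 by (simp add: awalk_simps)
    then show "\<exists>p. awalk u p y \<and> length p = 2" by (intro exI[of _ "[(u, w), (w, y)]"]) simp
  qed (auto simp: numeral_2_eq_2 length_Suc_conv awalk_simps)
  let ?d = "graph_dist G u x"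
  have iff: "?d = ereal (real n) \<longleftrightarrow>
      (\<exists>p. awalk u p x \<and> length p = n) \<and> (\<forall>m<n. \<nexists>p. awalk u p x \<and> length p = m)" for n
  proof
    assume d: "?d = ereal (real n)"
    show "(\<exists>p. awalk u p x \<and> length p = n) \<and> (\<forall>m<n. \<nexists>p. awalk u p x \<and> length p = m)"
    proof (intro conjI allI impI notI)
      show "\<exists>p. awalk u p x \<and> length p = n" using graph_dist_attained[OF d] by blast
      fix m assume "m < n" "\<exists>p. awalk u p x \<and> length p = m"
      then show False using graph_dist_le[of u _ x] d by fastforce
    qed
  next
    assume R: "(\<exists>p. awalk u p x \<and> length p = n) \<and> (\<forall>m<n. \<nexists>p. awalk u p x \<and> length p = m)"
    then have "ereal (real n) \<le> ?d" by (intro graph_dist_ge) (metis not_le)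
    then show "?d = ereal (real n)" using R graph_dist_le[of u _ x] by (metis order_antisym)
  qed
  have walk0': "(\<exists>p. awalk u p y \<and> length p = 0) \<longleftrightarrow> y = u" for y
    using walk0 by auto
  have d0: "?d = 0 \<longleftrightarrow> near (parcs G) u x = 0"
    using iff[of 0] walk0'[of x] by (simp add: near_def zero_ereal_def)
  have d1: "?d = 1 \<longleftrightarrow> near (parcs G) u x = 1"
    using iff[of 1] walk0'[of x] walk1[of x] by (simp add: near_def one_ereal_def)
  have "?d = 2 \<longleftrightarrow> (\<exists>p. awalk u p x \<and> length p = 2) \<and>
      \<not> (\<exists>p. awalk u p x \<and> length p = 0) \<and> \<not> (\<exists>p. awalk u p x \<and> length p = 1)"
    using iff[of 2] by (auto simp: less_2_cases_iff)
  then have d2: "?d = 2 \<longleftrightarrow> near (parcs G) u x = 2"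
    unfolding walk0' walk1 walk2 by (auto simp: near_def)
  have "near (parcs G) u x \<in> {0, 1, 2, 3}" by (simp add: near_def)
  moreover have "?d \<le> ereal (real k)" if "?d \<in> {0, 1, 2}"
    using that assms(1) by (auto simp: zero_ereal_def one_ereal_def)
  ultimately show ?thesis
    using d0 d1 d2 by (auto simp: probe_def coarse_def)
qed

text \<open>The cop discards surplus information. Equal histories give equal coarse answers, so
  every consistent walk agrees with the true one in the round in which the coarse strategy locates
  the robber.\<close>

lemma cops_win_if_winning:
  assumes "2 \<le> k" "winning (pverts G) (parcs G) (pverts G)"
  shows "cops_win k G 1"
proof -
  obtain \<tau> where \<tau>: "range \<tau> \<subseteq> pverts G" and win: "\<And>x. x 0 \<in> pverts G \<Longrightarrow>
     (\<And>n. x (Suc n) \<in> nbhd (parcs G) {x n}) \<Longrightarrow>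
      (\<exists>n. \<forall>y. y 0 \<in> pverts G \<and> (\<forall>n. y (Suc n) \<in> nbhd (parcs G) {y n}) \<and>
         answers (parcs G) \<tau> y (Suc n) = answers (parcs G) \<tau> x (Suc n) \<longrightarrow> y n = x n)"
    using winning_strategy[OF assms(2)] by metis
  define \<sigma> where "\<sigma> h = [\<tau> (map (\<lambda>ps. coarse (hd ps)) h)]" for h
  have ans: "answers (parcs G) \<tau> y n = map (\<lambda>ps. coarse (hd ps)) (history k G \<sigma> y n)" for y n
  proof (induction n)
    case (Suc n)
    have "\<tau> h \<in> pverts G" for h using \<tau> by blast
    then show ?case using Suc by (simp add: \<sigma>_def coarse_probe[OF assms(1)])
  qed simp
  have nbhd: "x (Suc n) \<in> nbhd (parcs G) {x n}" if "robber_walk G x" for x n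
    using that by (auto simp: robber_walk_def nbhd_def)
  show ?thesis
    unfolding cops_win_def
  proof (rule exI[of _ \<sigma>], intro conjI allI impI)
    show "cop_strategy 1 G \<sigma>"
      using \<tau> by (auto simp: cop_strategy_def \<sigma>_def)
    fix x assume x: "robber_walk G x"
    from x obtain n where n: "\<forall>y. y 0 \<in> pverts G \<and> (\<forall>n. y (Suc n) \<in> nbhd (parcs G) {y n}) \<and>
         answers (parcs G) \<tau> y (Suc n) = answers (parcs G) \<tau> x (Suc n) \<longrightarrow> y n = x n"
      using win[of x] nbhd[OF x] by (auto simp: robber_walk_def)
    have "y n = x n" if "robber_walk G y" "history k G \<sigma> y (Suc n) = history k G \<sigma> x (Suc n)" for y
      using n[rule_format, of y] nbhd[OF that(1)] that(1) that(2)
      unfolding ans by (auto simp: robber_walk_def simp del: history.simps)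
    then have "candidates k G \<sigma> x n = {x n}"
      using x unfolding candidates_def by blast
    then show "\<exists>n v. candidates k G \<sigma> x n = {v}" by blast
  qed
qed

end

section \<open>Vertices with long legs\<close>

lemma winning_subsingleton: "u \<in> V \<Longrightarrow> S \<subseteq> {w} \<Longrightarrow> winning V E S"
  by (rule winning.probing[of u]) blast+

lemma funpow_nbhd_mono: "S \<subseteq> S' \<Longrightarrow> (nbhd E ^^ t) S \<subseteq> (nbhd E ^^ t) S'"
  by (induction t) (simp_all add: nbhd_mono)

lemma funpow_nbhd_mono_time:
  assumes "s \<le> t" shows "(nbhd E ^^ s) S \<subseteq> (nbhd E ^^ t) S"
  using assms
proof (induction t rule: dec_induct)
  case (step t)
  then show ?case by (auto simp: nbhd_def)
qed simp

text \<open>Adds up the durations of consecutive phases; \<open>(nbhd E ^^ t) S\<close> is what the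
  robber can reach in \<open>t\<close> moves when no probe excludes anything.\<close>

lemma funpow_nbhd_add:
  assumes "S' \<subseteq> (nbhd E ^^ s) S" "S'' \<subseteq> (nbhd E ^^ t) S'" "s + t \<le> r"
  shows "S'' \<subseteq> (nbhd E ^^ r) S"
proof -
  have "S'' \<subseteq> (nbhd E ^^ t) ((nbhd E ^^ s) S)"
    using assms(2) funpow_nbhd_mono[OF assms(1)] by (rule subset_trans)
  also have "\<dots> = (nbhd E ^^ (t + s)) S" by (simp add: funpow_add)
  also have "\<dots> \<subseteq> (nbhd E ^^ r) S"
    using assms(3) by (intro funpow_nbhd_mono_time) simp
  finally show ?thesis .
qed

text \<open>
  A vertex \<open>v\<close> from which long paths, the legs, lead away. The leg \<open>lam x\<close> through which a vertex
  \<open>x\<close> is reached from \<open>v\<close> is known everywhere, but the distance \<open>del x\<close> from \<open>v\<close> need only be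
  correct up to the length of the leg; behind the end of the leg it may be constant.
\<close>

locale spider =
  fixes V :: "'v set" and E :: "('v \<times> 'v) set" and v :: 'v
    and lam :: "'v \<Rightarrow> 'l" and del :: "'v \<Rightarrow> nat" and J :: "'l set" and R :: "'l \<Rightarrow> nat"
  assumes finite_legs: "finite J"
    and center: "v \<in> V" "del v = 0"
    and edges: "E \<subseteq> V \<times> V" "sym E"
    and depth_pos: "\<And>x. x \<in> V \<Longrightarrow> x \<noteq> v \<Longrightarrow> 0 < del x"
    and leg_in: "\<And>x. x \<in> V \<Longrightarrow> x \<noteq> v \<Longrightarrow> lam x \<in> J"
    and edge_leg: "\<And>x y. (x, y) \<in> E \<Longrightarrow> x \<noteq> v \<Longrightarrow> y \<noteq> v \<Longrightarrow> lam x = lam y"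
    and edge_depth: "\<And>x y. (x, y) \<in> E \<Longrightarrow>
      del y = Suc (del x) \<or> del x = Suc (del y) \<or> del x = del y \<and> R (lam x) \<le> del x"
    and edge_center: "\<And>y. (v, y) \<in> E \<Longrightarrow> del y = 1"
    and unique: "\<And>x y. x \<in> V \<Longrightarrow> y \<in> V \<Longrightarrow> x \<noteq> v \<Longrightarrow> y \<noteq> v \<Longrightarrow> lam x = lam y \<Longrightarrow>
      del x = del y \<Longrightarrow> del x < R (lam x) \<Longrightarrow> x = y"
    and points: "\<And>j i. j \<in> J \<Longrightarrow> 0 < i \<Longrightarrow> i < R j \<Longrightarrow> \<exists>x\<in>V. x \<noteq> v \<and> lam x = j \<and> del x = i"
    and inward: "\<And>x. x \<in> V \<Longrightarrow> x \<noteq> v \<Longrightarrow> del x < R (lam x) \<Longrightarrow> \<exists>y\<in>V. (y, x) \<in> E \<and> Suc (del y) = del x"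
    and long: "\<And>j. j \<in> J \<Longrightarrow> 4 * 3 ^ card J + 2 \<le> R j"
begin

abbreviation W :: "'v set \<Rightarrow> bool" where "W \<equiv> winning V E"
abbreviation N :: "'v set \<Rightarrow> 'v set" where "N \<equiv> nbhd E"

definition pt :: "'l \<Rightarrow> nat \<Rightarrow> 'v" where
  "pt j i = (if i = 0 then v else SOME x. x \<in> V \<and> x \<noteq> v \<and> lam x = j \<and> del x = i)"

lemma length_ge: "j \<in> J \<Longrightarrow> 6 \<le> R j"
proof -
  have "(1::nat) \<le> 3 ^ card J" by simp
  then show "j \<in> J \<Longrightarrow> 6 \<le> R j" using long[of j] by linarith
qed

lemma pt_0: "pt j 0 = v" by (simp add: pt_def)

lemma pt_pos:
  assumes "j \<in> J" "0 < i" "i < R j"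
  shows "pt j i \<in> V" "pt j i \<noteq> v" "lam (pt j i) = j" "del (pt j i) = i"
proof -
  have "\<exists>x. x \<in> V \<and> x \<noteq> v \<and> lam x = j \<and> del x = i" using points[OF assms] by blast
  from someI_ex[OF this] show "pt j i \<in> V" "pt j i \<noteq> v" "lam (pt j i) = j" "del (pt j i) = i"
    using assms(2) by (auto simp: pt_def)
qed

lemma eq_ptI: "x \<in> V \<Longrightarrow> x = v \<or> lam x = j \<Longrightarrow> del x = i \<Longrightarrow> j \<in> J \<Longrightarrow> i < R j \<Longrightarrow> x = pt j i"
proof -
  assume x: "x \<in> V" "x = v \<or> lam x = j" "del x = i" "j \<in> J" "i < R j"
  show "x = pt j i"
  proof (cases "i = 0")
    case True
    then show ?thesis using depth_pos[OF x(1)] x(3) pt_0 by auto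
  next
    case False
    then have "x \<noteq> v" "lam x = j" using x center(2) by auto
    then show ?thesis using unique[OF x(1)] pt_pos[OF x(4) _ x(5)] False x by simp
  qed
qed

lemma edge_pt:
  assumes "j \<in> J" "Suc i < R j"
  shows "(pt j i, pt j (Suc i)) \<in> E" "(pt j (Suc i), pt j i) \<in> E"
proof -
  note P = pt_pos[OF assms(1) _ assms(2), simplified]
  obtain y where y: "y \<in> V" "(y, pt j (Suc i)) \<in> E" "Suc (del y) = Suc i"
    using inward[of "pt j (Suc i)"] P assms by auto
  have "y = v \<or> lam y = j" using edge_leg[OF y(2)] P by auto
  then have "y = pt j i" using y assms by (intro eq_ptI) auto
  then show "(pt j i, pt j (Suc i)) \<in> E" using y by simp
  then show "(pt j (Suc i), pt j i) \<in> E" using edges(2) by (rule symD[rotated])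
qed

lemma center_edge:
  assumes "x \<in> V" "del x = 1" shows "(v, x) \<in> E"
proof -
  have x: "x \<noteq> v" using assms center by auto
  have "del x < R (lam x)" using length_ge[OF leg_in[OF assms(1) x]] assms by simp
  then show ?thesis using inward[OF assms(1) x] depth_pos assms by fastforce
qed

lemma nbr_pt:
  assumes "(pt j \<mu>, x) \<in> E" "j \<in> J" "0 < \<mu>" "\<mu> < R j"
  shows "x = v \<or> lam x = j" "del x = Suc \<mu> \<or> Suc (del x) = \<mu>"
proof -
  note P = pt_pos[OF assms(2-4)]
  show "x = v \<or> lam x = j" using edge_leg[OF assms(1) P(2)] P(3) by metis
  show "del x = Suc \<mu> \<or> Suc (del x) = \<mu>" using edge_depth[OF assms(1)] assms(4) unfolding P(3,4) by auto
qed

section \<open>What a single probe reveals\<close>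

lemma near_pt_1:
  assumes "near E (pt j \<mu>) x = 1" "j \<in> J" "0 < \<mu>" "\<mu> < R j"
  shows "x = v \<or> lam x = j" "del x = Suc \<mu> \<or> Suc (del x) = \<mu>"
proof -
  have "(pt j \<mu>, x) \<in> E" using assms(1) by (auto simp: near_def split: if_splits)
  from nbr_pt[OF this assms(2-)] show "x = v \<or> lam x = j" "del x = Suc \<mu> \<or> Suc (del x) = \<mu>" .
qed

text \<open>The first case is the way through \<open>v\<close> to the first vertex of another leg,
  which is short enough only from depth 1. If \<open>Suc \<mu> = R j\<close>, depths further out
  need not be exact, hence the weaker \<open>\<mu> < del x\<close>.\<close>

lemma near_pt_2:
  assumes "near E (pt j \<mu>) x = 2" "j \<in> J" "0 < \<mu>" "\<mu> < R j" "x \<in> V"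
  shows "\<mu> = 1 \<and> del x = 1 \<or>
    (x = v \<or> lam x = j) \<and> (del x + 2 = \<mu> \<or> \<mu> < del x \<and> (Suc \<mu> < R j \<longrightarrow> del x = \<mu> + 2))"
proof -
  obtain w where w: "(pt j \<mu>, w) \<in> E" "(w, x) \<in> E" "x \<noteq> pt j \<mu>"
    using assms(1) by (auto simp: near_def split: if_splits)
  note wn = nbr_pt[OF w(1) assms(2-4)]
  show ?thesis
  proof (cases "w = v")
    case True
    then show ?thesis using wn edge_center w(2) center by auto
  next
    case False
    then have lam: "lam w = j" "x = v \<or> lam x = j" using wn edge_leg[OF w(2)] by metis+
    have "del x = Suc (del w) \<or> Suc (del x) = del w \<or> del x = del w \<and> R j \<le> del w"
      using edge_depth[OF w(2)] lam(1) by auto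
    moreover have "del x \<noteq> \<mu>" using eq_ptI[OF assms(5) lam(2) _ assms(2)] w(3) assms(4) by auto
    ultimately have "del x + 2 = \<mu> \<or> \<mu> < del x \<and> (Suc \<mu> < R j \<longrightarrow> del x = \<mu> + 2)"
      using wn(2) assms(4) by auto
    then show ?thesis using lam(2) by blast
  qed
qed

lemma near_pt_le:
  assumes "near E (pt j \<mu>) x = 3" "j \<in> J" "0 < \<mu>" "\<mu> < R j" "x \<in> V" "x = v \<or> lam x = j"
  shows "del x \<noteq> \<mu>" "Suc (del x) \<noteq> \<mu>" "del x + 2 \<noteq> \<mu>" "Suc \<mu> < R j \<Longrightarrow> del x \<noteq> Suc \<mu>"
proof -
  have n: "x \<noteq> pt j \<mu>" "(pt j \<mu>, x) \<notin> E" "\<And>w. (pt j \<mu>, w) \<in> E \<Longrightarrow> (w, x) \<notin> E"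
    using assms(1) by (auto simp: near_def split: if_splits)
  note eq = eq_ptI[OF assms(5,6) refl assms(2)]
  show "del x \<noteq> \<mu>" using eq n(1) assms(4) by auto
  show "Suc (del x) \<noteq> \<mu>" using eq n(2) edge_pt[OF assms(2), of "del x"] assms(4) by auto
  show "Suc \<mu> < R j \<Longrightarrow> del x \<noteq> Suc \<mu>" using eq n(2) edge_pt[OF assms(2), of \<mu>] by auto
  show "del x + 2 \<noteq> \<mu>"
  proof
    assume "del x + 2 = \<mu>"
    then show False
      using eq n(3)[of "pt j (Suc (del x))"] edge_pt[OF assms(2), of "del x"]
        edge_pt[OF assms(2), of "Suc (del x)"] assms(4) by auto
  qed
qed

lemma near_cases: "near E u x \<in> {0, 1, 2, 3}" by (simp add: near_def)

lemma probeI: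
  assumes "u \<in> V"
    and "\<And>r. r \<in> {1, 2, 3} \<Longrightarrow>
      (\<exists>w. {x \<in> S. near E u x = r} \<subseteq> {w}) \<or> W (N {x \<in> S. near E u x = r})"
  shows "W S"
proof (rule winning.probing[OF assms(1)])
  fix r
  show "(\<exists>w. {x \<in> S. near E u x = r} \<subseteq> {w}) \<or> W (N {x \<in> S. near E u x = r})"
  proof (cases "r \<in> {1, 2, 3}")
    case False
    have "{x \<in> S. near E u x = r} \<subseteq> {u}"
    proof
      fix x assume "x \<in> {x \<in> S. near E u x = r}"
      then have "near E u x = 0" using near_cases[of u x] False by auto
      then show "x \<in> {u}" by (simp add: near_def split: if_splits)
    qed
    then show ?thesis by blast
  qed (rule assms(2))
qed

lemma W_mono_nbhd: "W (N S) \<Longrightarrow> S' \<subseteq> S \<Longrightarrow> W (N S')"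
  using winning_mono nbhd_mono by metis

text \<open>No candidate on leg \<open>j\<close> lies beyond \<open>pt j \<mu>\<close>, and
  \<open>2 \<le> \<mu>\<close> keeps other legs out of sight, so the answers 1 and 2 each name a
  single vertex further in. The answer 3 clears the depths \<open>\<mu>\<close>,
  \<open>\<mu> - 1\<close> and \<open>\<mu> - 2\<close>.\<close>

lemma free_probe:
  assumes j: "j \<in> J" "2 \<le> \<mu>" "\<mu> < R j" and S: "S \<subseteq> V"
    and bound: "\<And>x. x \<in> S \<Longrightarrow> x = v \<or> lam x = j \<Longrightarrow> del x \<le> \<mu>"
    and rest: "W (N {x \<in> S. \<not> ((x = v \<or> lam x = j) \<and> \<mu> \<le> del x + 2)})"
  shows "W S"
proof (rule probeI)
  have \<mu>: "0 < \<mu>" "\<mu> < R j" using j by auto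
  show "pt j \<mu> \<in> V" using pt_pos[OF j(1) \<mu>] by simp
  fix r :: nat assume "r \<in> {1, 2, 3}"
  then consider "r = 1" | "r = 2" | "r = 3" by auto
  then show "(\<exists>w. {x \<in> S. near E (pt j \<mu>) x = r} \<subseteq> {w}) \<or> W (N {x \<in> S. near E (pt j \<mu>) x = r})"
  proof cases
    case 1
    have "{x \<in> S. near E (pt j \<mu>) x = r} \<subseteq> {pt j (\<mu> - 1)}"
    proof
      fix x assume "x \<in> {x \<in> S. near E (pt j \<mu>) x = r}"
      then have x: "x \<in> S" "near E (pt j \<mu>) x = 1" using 1 by auto
      from near_pt_1[OF x(2) j(1) \<mu>] bound[OF x(1)] have "x = v \<or> lam x = j" "Suc (del x) = \<mu>" by auto
      then show "x \<in> {pt j (\<mu> - 1)}" using eq_ptI[of x j "\<mu> - 1"] x S j by auto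
    qed
    then show ?thesis by blast
  next
    case 2
    have "{x \<in> S. near E (pt j \<mu>) x = r} \<subseteq> {pt j (\<mu> - 2)}"
    proof
      fix x assume "x \<in> {x \<in> S. near E (pt j \<mu>) x = r}"
      then have x: "x \<in> S" "near E (pt j \<mu>) x = 2" "x \<in> V" using 2 S by auto
      from near_pt_2[OF x(2) j(1) \<mu> x(3)] bound[OF x(1)] j(2)
      have "x = v \<or> lam x = j" "del x + 2 = \<mu>" by auto
      then show "x \<in> {pt j (\<mu> - 2)}" using eq_ptI[of x j "\<mu> - 2"] x S j by auto
    qed
    then show ?thesis by blast
  next
    case 3
    have "\<not> ((x = v \<or> lam x = j) \<and> \<mu> \<le> del x + 2)" if x: "x \<in> S" "near E (pt j \<mu>) x = 3" for x
    proof
      assume *: "(x = v \<or> lam x = j) \<and> \<mu> \<le> del x + 2"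
      have "x \<in> V" using S x by auto
      then show False
        using near_pt_le(1-3)[OF x(2) j(1) \<mu>] bound[OF x(1)] * by linarith
    qed
    then have "{x \<in> S. near E (pt j \<mu>) x = r} \<subseteq> {x \<in> S. \<not> ((x = v \<or> lam x = j) \<and> \<mu> \<le> del x + 2)}"
      using 3 by auto
    then show ?thesis using W_mono_nbhd[OF rest] by blast
  qed
qed

text \<open>Every neighbour of \<open>pt i 1\<close> is \<open>v\<close> or on the clear leg
  \<open>i\<close>, so the answer 1 locates the robber at \<open>v\<close>; the answer 2 can only
  come from first vertices of other legs.\<close>

lemma guard_from_leg:
  assumes i: "i \<in> J" and S: "S \<subseteq> V" "\<And>x. x \<in> S \<Longrightarrow> x \<noteq> v \<Longrightarrow> lam x \<noteq> i"
    and W1: "W (N {x \<in> S. del x = 1})" and W2: "W (N {x \<in> S. 2 \<le> del x})"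
  shows "W S"
proof (rule probeI)
  have i1: "0 < (1::nat)" "1 < R i" "Suc 1 < R i" using length_ge[OF i] by auto
  show "pt i 1 \<in> V" using pt_pos[OF i i1(1,2)] by simp
  fix r :: nat assume "r \<in> {1, 2, 3}"
  then consider "r = 1" | "r = 2" | "r = 3" by auto
  then show "(\<exists>w. {x \<in> S. near E (pt i 1) x = r} \<subseteq> {w}) \<or> W (N {x \<in> S. near E (pt i 1) x = r})"
  proof cases
    case 1
    have "{x \<in> S. near E (pt i 1) x = r} \<subseteq> {v}"
      using near_pt_1(1)[OF _ i i1(1,2)] S(2) 1 by auto
    then show ?thesis by blast
  next
    case 2
    have "del x = 1" if x: "x \<in> S" "near E (pt i 1) x = 2" for x
      using near_pt_2[OF x(2) i i1(1,2) subsetD[OF S(1) x(1)]] S(2)[OF x(1)] i1(3) center by (cases "x = v") auto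
    then have "{x \<in> S. near E (pt i 1) x = r} \<subseteq> {x \<in> S. del x = 1}" using 2 by auto
    then show ?thesis using W_mono_nbhd[OF W1] by blast
  next
    case 3
    have "2 \<le> del x" if x: "x \<in> S" "near E (pt i 1) x = 3" for x
    proof -
      have n: "\<And>w. (pt i 1, w) \<in> E \<Longrightarrow> (w, x) \<notin> E" "(pt i 1, x) \<notin> E"
        using x by (auto simp: near_def split: if_splits)
      have e: "(pt i 1, v) \<in> E" using edge_pt(2)[OF i, of 0] i1 by (simp add: pt_0)
      have "del x \<noteq> 1" using n(1)[OF e] center_edge[OF subsetD[OF S(1) x(1)]] by blast
      moreover have "del x \<noteq> 0" using n(2) e depth_pos[OF subsetD[OF S(1) x(1)]] by auto
      ultimately show ?thesis by simp
    qed
    then have "{x \<in> S. near E (pt i 1) x = r} \<subseteq> {x \<in> S. 2 \<le> del x}" using 3 by auto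
    then show ?thesis using W_mono_nbhd[OF W2] by blast
  qed
qed

text \<open>Probing \<open>v\<close> itself shows depths up to 2 but not the leg, so the answers 1
  and 2 remain as obligations.\<close>

lemma guard_from_center:
  assumes S: "S \<subseteq> V"
    and W1: "(\<exists>w. {x \<in> S. del x = 1} \<subseteq> {w}) \<or> W (N {x \<in> S. del x = 1})"
    and W2: "(\<exists>w. {x \<in> S. del x = 2} \<subseteq> {w}) \<or> W (N {x \<in> S. del x = 2})"
    and W3: "W (N {x \<in> S. 3 \<le> del x})"
  shows "W S"
proof (rule probeI[OF center(1)])
  have long': "2 < R (lam x)" if "x \<in> V" "x \<noteq> v" for x using length_ge[OF leg_in[OF that]] by simp
  fix r :: nat assume "r \<in> {1, 2, 3}"
  then consider "r = 1" | "r = 2" | "r = 3" by auto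
  then show "(\<exists>w. {x \<in> S. near E v x = r} \<subseteq> {w}) \<or> W (N {x \<in> S. near E v x = r})"
  proof cases
    case 1
    have "{x \<in> S. near E v x = r} \<subseteq> {x \<in> S. del x = 1}"
      using 1 edge_center by (auto simp: near_def split: if_splits)
    then show ?thesis using W1 W_mono_nbhd by (meson subset_trans)
  next
    case 2
    have "del x = 2" if x: "x \<in> S" "near E v x = 2" for x
    proof -
      obtain w where w: "(v, w) \<in> E" "(w, x) \<in> E" "x \<noteq> v" "(v, x) \<notin> E"
        using x by (auto simp: near_def split: if_splits)
      then have "del w = 1" "w \<in> V" "x \<in> V" "w \<noteq> v" using edge_center edges center by auto
      moreover have "del x \<noteq> 0" using depth_pos[of x] w \<open>x \<in> V\<close> by auto
      ultimately show ?thesis using edge_depth[OF w(2)] long'[of w] by auto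
    qed
    then have "{x \<in> S. near E v x = r} \<subseteq> {x \<in> S. del x = 2}" using 2 by auto
    then show ?thesis using W2 W_mono_nbhd by (meson subset_trans)
  next
    case 3
    have "3 \<le> del x" if x: "x \<in> S" "near E v x = 3" for x
    proof -
      have xV: "x \<in> V" "x \<noteq> v" using x S by (auto simp: near_def)
      have n: "\<And>w. (v, w) \<in> E \<Longrightarrow> (w, x) \<notin> E" "(v, x) \<notin> E"
        using x by (auto simp: near_def split: if_splits)
      have "del x \<noteq> 1" using center_edge[OF xV(1)] n(2) by blast
      moreover have "del x \<noteq> 2"
      proof
        assume "del x = 2"
        then obtain y where "y \<in> V" "(y, x) \<in> E" "del y = 1"
          using inward[OF xV] long'[OF xV] by auto
        then show False using center_edge n(1) by blast
      qed
      ultimately show ?thesis using depth_pos[OF xV] by linarith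
    qed
    then have "{x \<in> S. near E v x = r} \<subseteq> {x \<in> S. 3 \<le> del x}" using 3 by auto
    then show ?thesis using W_mono_nbhd[OF W3] by blast
  qed
qed

section \<open>Spreading along legs and pushing back\<close>

lemma nbhdE:
  assumes "y \<in> N S" "S \<subseteq> V"
  obtains x where "x \<in> S" "y \<in> V" "del y \<le> Suc (del x)" "del x \<le> Suc (del y)"
    "x \<noteq> v \<Longrightarrow> y \<noteq> v \<Longrightarrow> lam x = lam y"
proof (cases "y \<in> S")
  case True
  then show ?thesis using that[of y] assms by auto
next
  case False
  then obtain x where x: "x \<in> S" "(x, y) \<in> E" using assms(1) by (auto simp: nbhd_def)
  then have "y \<in> V" using edges by auto
  then show ?thesis using that[of x] x edge_depth[OF x(2)] edge_leg[OF x(2)] by auto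
qed

lemma nbhd_subset: "S \<subseteq> V \<Longrightarrow> N S \<subseteq> V"
  using edges by (auto simp: nbhd_def)

text \<open>The value \<open>m i = 0\<close> encodes that leg \<open>i\<close> is clear, as vertices
  other than \<open>v\<close> have positive depth. The vertex \<open>v\<close> is never excluded,
  and legs outside \<open>B\<close> are unrestricted.\<close>

definition bounded :: "'l set \<Rightarrow> ('l \<Rightarrow> nat) \<Rightarrow> 'v set \<Rightarrow> bool" where
  "bounded B m S \<longleftrightarrow> S \<subseteq> V \<and> (\<forall>x\<in>S. x \<noteq> v \<longrightarrow> lam x \<in> B \<longrightarrow> del x \<le> m (lam x))"

text \<open>The cop can keep the robber away from \<open>v\<close> as long as the legs in \<open>Z\<close> are clear.\<close>

definition guardable :: "'l set \<Rightarrow> bool" where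
  "guardable Z \<longleftrightarrow> (\<forall>S\<subseteq>V. (\<forall>x\<in>S. x \<noteq> v \<longrightarrow> lam x \<notin> Z) \<longrightarrow> W (N {x \<in> S. 2 \<le> del x}) \<longrightarrow> W S)"

lemma bounded_nbhd:
  assumes "bounded B m S" "\<And>i. i \<in> B \<Longrightarrow> m' i = Suc (m i)"
  shows "bounded B m' (N S)"
  unfolding bounded_def
proof (intro conjI ballI impI)
  have S: "S \<subseteq> V" using assms by (simp add: bounded_def)
  show "N S \<subseteq> V" using nbhd_subset[OF S] .
  fix y assume y: "y \<in> N S" "y \<noteq> v" "lam y \<in> B"
  from nbhdE[OF y(1) S] obtain x where x: "x \<in> S" "del y \<le> Suc (del x)" "x \<noteq> v \<Longrightarrow> lam x = lam y"
    using y(2) by blast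
  show "del y \<le> m' (lam y)"
    using x y assms center by (cases "x = v") (force simp: bounded_def)+
qed

lemma bounded_funpow_nbhd:
  assumes "bounded B m S"
  shows "bounded B (\<lambda>i. m i + t) ((N ^^ t) S)"
proof (induction t)
  case (Suc t)
  then show ?case using bounded_nbhd[OF Suc] by simp
qed (use assms in simp)

text \<open>
  The cop alternates between guarding \<open>v\<close> and probing the outer end of the contaminated part of
  the leg \<open>j\<close>, which shrinks by two at each such probe and grows by one at each move of the robber.
\<close>

lemma guard_and_probe:
  assumes Z: "guardable Z" "Z \<subseteq> B" "\<And>z. z \<in> Z \<Longrightarrow> m z = 0"
    and j: "j \<in> B" "B \<subseteq> J" "m j + 1 < R j"
    and S: "bounded B m S"
    and rest: "\<And>S'. S' \<subseteq> (N ^^ 2) S \<Longrightarrow>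
      bounded B (\<lambda>i. if i = j then (if m j < 3 then 0 else m j - 1) else if m i = 0 then 0 else m i + 2) S'
      \<Longrightarrow> W S'"
  shows "W S"
proof -
  let ?m = "\<lambda>i. if i = j then (if m j < 3 then 0 else m j - 1) else if m i = 0 then 0 else m i + 2"
  have jJ: "j \<in> J" using j by auto
  have SV: "S \<subseteq> V" and Sm: "\<And>x. x \<in> S \<Longrightarrow> x \<noteq> v \<Longrightarrow> lam x \<in> B \<Longrightarrow> del x \<le> m (lam x)"
    using S by (auto simp: bounded_def)
  define S1 where "S1 = {x \<in> S. 2 \<le> del x}"
  \<comment> \<open>After one move leg \<open>j\<close> is contaminated up to
    \<open>m j + 1\<close>. The probe there clears three depths, leaving \<open>m j - 2\<close>, and
    the next move gives \<open>m j - 1\<close>. The maximum serves the condition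
    \<open>2 \<le> \<mu>\<close> of \<open>free_probe\<close>.\<close>
  define \<mu> where "\<mu> = max 2 (Suc (m j))"
  define S2 where "S2 = {x \<in> N S1. \<not> ((x = v \<or> lam x = j) \<and> \<mu> \<le> del x + 2)}"
  have S1V: "S1 \<subseteq> V" using SV by (auto simp: S1_def)
  \<comment> \<open>One move after the guard \<open>v\<close> is still empty, so no clear leg can be
    entered by the second move. A leg with bound below 2 has become empty, since all its candidates
    were too close to \<open>v\<close>.\<close>
  have S1: "x \<noteq> v" "1 \<le> del x" "lam x \<in> B \<Longrightarrow> del x \<le> Suc (m (lam x)) \<and> 2 \<le> m (lam x)"
    if x: "x \<in> N S1" for x
  proof -
    obtain y where y: "y \<in> S1" "x \<in> V" "del x \<le> Suc (del y)" "del y \<le> Suc (del x)"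
      "y \<noteq> v \<Longrightarrow> x \<noteq> v \<Longrightarrow> lam y = lam x" using nbhdE[OF x S1V] by blast
    then have y': "y \<in> S" "2 \<le> del y" by (auto simp: S1_def)
    then show "1 \<le> del x" using y by simp
    then show xv: "x \<noteq> v" using center by auto
    have "y \<noteq> v" using y' center by auto
    then show "lam x \<in> B \<Longrightarrow> del x \<le> Suc (m (lam x)) \<and> 2 \<le> m (lam x)"
      using y y' xv Sm[OF y'(1)] by auto
  qed
  have "W (N S2)"
  proof (rule rest)
    have S2V: "S2 \<subseteq> V" using nbhd_subset[OF S1V] by (auto simp: S2_def)
    have "N S2 \<subseteq> N (N S)" by (intro nbhd_mono) (use nbhd_mono[of S1 S E] in \<open>auto simp: S1_def S2_def\<close>)
    then show "N S2 \<subseteq> (N ^^ 2) S" by (simp add: numeral_2_eq_2)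
    show "bounded B ?m (N S2)"
      unfolding bounded_def
    proof (intro conjI ballI impI)
      show "N S2 \<subseteq> V" using nbhd_subset[OF S2V] .
      fix y assume y: "y \<in> N S2" "y \<noteq> v" "lam y \<in> B"
      obtain x where x: "x \<in> S2" "del y \<le> Suc (del x)" "x \<noteq> v \<Longrightarrow> lam x = lam y"
        using nbhdE[OF y(1) S2V] y(2) by blast
      have xN: "x \<in> N S1" and x': "\<not> ((x = v \<or> lam x = j) \<and> \<mu> \<le> del x + 2)"
        using x(1) by (auto simp: S2_def)
      have lam: "lam x = lam y" using S1(1)[OF xN] x by simp
      have b: "del x \<le> Suc (m (lam y))" "2 \<le> m (lam y)" using S1(3)[OF xN] y lam by auto
      show "del y \<le> ?m (lam y)"
        using x(2) x' lam b S1(2)[OF xN] by (auto simp: \<mu>_def)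
    qed
  qed
  then have "W (N S1)"
    unfolding S2_def
  proof (rule free_probe[OF jJ, rotated -1])
    show "2 \<le> \<mu>" "\<mu> < R j" using j(3) length_ge[OF jJ] by (auto simp: \<mu>_def)
    show "N S1 \<subseteq> V" using nbhd_subset[OF S1V] .
    fix x assume "x \<in> N S1" "x = v \<or> lam x = j"
    then show "del x \<le> \<mu>" using S1[of x] j by (auto simp: \<mu>_def)
  qed
  moreover have "lam x \<notin> Z" if "x \<in> S" "x \<noteq> v" for x
  proof
    assume z: "lam x \<in> Z"
    then have "del x \<le> 0" using Sm[OF that] Z(2) Z(3)[OF z] by auto
    then show False using depth_pos[OF subsetD[OF SV that(1)] that(2)] by simp
  qed
  ultimately show ?thesis
    using Z(1)[unfolded guardable_def, rule_format, OF SV] unfolding S1_def by simp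
qed

lemma bounded_mono:
  "bounded B m S \<Longrightarrow> (\<And>i. i \<in> B \<Longrightarrow> m i \<le> m' i) \<Longrightarrow> bounded B m' S"
proof -
  assume S: "bounded B m S" and le: "\<And>i. i \<in> B \<Longrightarrow> m i \<le> m' i"
  have "del x \<le> m' (lam x)" if "x \<in> S" "x \<noteq> v" "lam x \<in> B" for x
    using S le[OF that(3)] that unfolding bounded_def by fastforce
  then show "bounded B m' S" using S unfolding bounded_def by simp
qed

text \<open>Each pass of \<open>guard_and_probe\<close> takes two rounds and lowers
  \<open>m j\<close> by at least 1. So \<open>2 * m j\<close> rounds suffice, and contaminated legs
  grow by no more than that while clear ones stay clear.\<close>

lemma clear_leg:
  assumes Z: "guardable Z" "Z \<subseteq> B" "\<And>z. z \<in> Z \<Longrightarrow> m z = 0"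
    and j: "j \<in> B" "B \<subseteq> J" "m j + 1 < R j"
    and S: "bounded B m S"
    and rest: "\<And>S'. S' \<subseteq> (N ^^ (2 * m j)) S \<Longrightarrow>
      bounded B (\<lambda>i. if i = j \<or> m i = 0 then 0 else m i + 2 * m j) S' \<Longrightarrow> W S'"
  shows "W S"
  using assms(3,6-)
proof (induction "m j" arbitrary: m S rule: less_induct)
  case less
  show ?case
  proof (cases "m j = 0")
    case True
    show ?thesis
      by (rule less.prems(4)) (use True less.prems(3) in \<open>auto simp: bounded_def\<close>)
  next
    case False
    let ?m = "\<lambda>i. if i = j then (if m j < 3 then 0 else m j - 1) else if m i = 0 then 0 else m i + 2"
    show ?thesis
    proof (rule guard_and_probe[OF Z(1,2) _ j(1,2) less.prems(2,3)])
      show "m z = 0" if "z \<in> Z" for z using less.prems(1)[OF that] .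
      fix S' assume S': "S' \<subseteq> (N ^^ 2) S" "bounded B ?m S'"
      show "W S'"
      proof (rule less.hyps[of ?m])
        show "?m j < m j" using False by auto
        show "?m z = 0" if "z \<in> Z" for z using less.prems(1)[OF that] by auto
        show "?m j + 1 < R j" using less.prems(2) by auto
        show "bounded B ?m S'" using S' by simp
        fix S'' assume S'': "S'' \<subseteq> (N ^^ (2 * ?m j)) S'"
          "bounded B (\<lambda>i. if i = j \<or> ?m i = 0 then 0 else ?m i + 2 * ?m j) S''"
        show "W S''"
        proof (rule less.prems(4))
          show "S'' \<subseteq> (N ^^ (2 * m j)) S"
            by (rule funpow_nbhd_add[OF S'(1) S''(1)]) (use False in auto)
          show "bounded B (\<lambda>i. if i = j \<or> m i = 0 then 0 else m i + 2 * m j) S''"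
            by (rule bounded_mono[OF S''(2)]) (use False in auto)
        qed
      qed
    qed
  qed
qed

text \<open>Clearing one leg takes at most \<open>2 * M\<close> rounds and lets the others grow to
  \<open>3 * M\<close>. For \<open>d = card D\<close> the time is the geometric sum
  \<open>2 * M * (1 + 3 + ... + 3 ^ (d - 1)) = (3 ^ d - 1) * M\<close>.\<close>

lemma clear_legs:
  assumes "guardable Z" "Z \<subseteq> B" "B \<subseteq> J" "finite D" "D \<subseteq> B"
    and "\<And>z. z \<in> Z \<Longrightarrow> m z = 0" "\<And>i. i \<in> B - D \<Longrightarrow> m i = 0"
    and "\<And>i. i \<in> D \<Longrightarrow> m i \<le> M" "\<And>i. i \<in> D \<Longrightarrow> M * 3 ^ card D + 2 \<le> R i"
    and "bounded B m S"
    and "\<And>S'. S' \<subseteq> (N ^^ ((3 ^ card D - 1) * M)) S \<Longrightarrow> bounded B (\<lambda>_. 0) S' \<Longrightarrow> W S'"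
  shows "W S"
  using assms(4-)
proof (induction D arbitrary: m M S rule: finite_induct)
  case empty
  show ?case
    by (rule empty.prems(7)) (use empty.prems(3,6) in \<open>auto simp: bounded_def\<close>)
next
  case (insert j D)
  obtain q where q: "3 ^ card D = Suc q" by (metis not0_implies_Suc power_not_zero zero_neq_numeral)
  have R: "M * 3 * Suc q + 2 \<le> R i" if "i \<in> insert j D" for i
    using insert.prems(5)[OF that] insert.hyps q by (simp add: algebra_simps)
  have "m j \<le> M" using insert.prems(4) by simp
  show ?case
  proof (rule clear_leg[OF assms(1,2) _ _ assms(3)])
    show "m z = 0" if "z \<in> Z" for z using insert.prems(2)[OF that] .
    show "j \<in> B" using insert.prems by simp
    show "bounded B m S" using insert.prems by simp
    show "m j + 1 < R j"
    proof (cases "M = 0")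
      case True
      have "j \<in> J" using insert.prems assms(3) by auto
      then show ?thesis using True \<open>m j \<le> M\<close> length_ge[of j] by simp
    next
      case False
      then show ?thesis using R[of j] \<open>m j \<le> M\<close> by (simp add: algebra_simps)
    qed
    fix S' assume S': "S' \<subseteq> (N ^^ (2 * m j)) S"
      "bounded B (\<lambda>i. if i = j \<or> m i = 0 then 0 else m i + 2 * m j) S'" (is "bounded B ?m S'")
    show "W S'"
    proof (rule insert.IH[of ?m "3 * M"])
      show "D \<subseteq> B" using insert.prems by simp
      show "?m z = 0" if "z \<in> Z" for z using insert.prems(2)[OF that] by simp
      show "?m i = 0" if "i \<in> B - D" for i using insert.prems(3)[of i] that by auto
      show "?m i \<le> 3 * M" if "i \<in> D" for i using insert.prems(4)[of i] that \<open>m j \<le> M\<close> by auto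
      show "3 * M * 3 ^ card D + 2 \<le> R i" if "i \<in> D" for i
        using R[of i] that q by (simp add: algebra_simps)
      show "bounded B ?m S'" using S' by simp
      fix S'' assume S'': "S'' \<subseteq> (N ^^ ((3 ^ card D - 1) * (3 * M))) S'" "bounded B (\<lambda>_. 0) S''"
      have "2 * m j + (3 ^ card D - 1) * (3 * M) \<le> (3 ^ card (insert j D) - 1) * M"
        using \<open>m j \<le> M\<close> insert.hyps q by (simp add: algebra_simps)
      from funpow_nbhd_add[OF S'(1) S''(1) this] S''(2) show "W S''"
        by (rule insert.prems(7))
    qed
  qed
qed

section \<open>Winning locally and guarding a branch vertex\<close>

lemma W_center: "S \<subseteq> {w} \<Longrightarrow> W S"
  using winning_subsingleton[OF center(1)] .

text \<open>
  The cop guards \<open>v\<close> by probing the first vertex of a clear leg. Only the answer 2 is ambiguous; the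
  robber is then on the first vertex of some leg in \<open>A\<close>, and probing the second vertex of one such
  leg removes it from \<open>A\<close>. Clearing the legs in turn at most triples the contamination of the others
  each time, which is why the legs have length at least \<open>4 * 3 ^ card J + 2\<close>.
\<close>

lemma local_win:
  assumes "A \<subset> J" "S \<subseteq> V" "\<And>x. x \<in> S \<Longrightarrow> x = v \<or> lam x \<in> A \<and> del x \<le> 4"
  shows "W S"
  using assms
proof (induction "card A" arbitrary: A S rule: less_induct)
  case less
  have finA: "finite A" using less.prems(1) finite_legs finite_subset by blast
  obtain i where i: "i \<in> J" "i \<notin> A" using less.prems(1) by blast
  have "guardable (J - A)"
    unfolding guardable_def
  proof (intro allI impI)
    fix S assume S: "S \<subseteq> V" "\<forall>x\<in>S. x \<noteq> v \<longrightarrow> lam x \<notin> J - A" "W (N {x \<in> S. 2 \<le> del x})"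
    have inA: "lam x \<in> A" if "x \<in> S" "x \<noteq> v" for x using S leg_in[of x] that by auto
    let ?T = "{x \<in> S. del x = 1}"
    have T: "y = v \<or> lam y \<in> A \<and> del y \<le> 2" if y: "y \<in> N ?T" for y
    proof -
      have TV: "?T \<subseteq> V" using S(1) by auto
      show ?thesis
      proof (rule nbhdE[OF y TV])
        fix x assume x: "x \<in> ?T" "del y \<le> Suc (del x)" "x \<noteq> v \<Longrightarrow> y \<noteq> v \<Longrightarrow> lam x = lam y"
        then have "x \<noteq> v" using center by auto
        then show ?thesis using x inA[of x] by (cases "y = v") auto
      qed
    qed
    have TV: "N ?T \<subseteq> V" using S(1) by (intro nbhd_subset) auto
    have "W (N ?T)"
    proof (cases "A = {}")
      case True
      then have "N ?T \<subseteq> {v}" using T by blast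
      then show ?thesis by (rule W_center)
    next
      case False
      then obtain j where j: "j \<in> A" by blast
      then have jJ: "j \<in> J" using less.prems(1) by blast
      let ?T' = "{x \<in> N ?T. \<not> ((x = v \<or> lam x = j) \<and> 2 \<le> del x + 2)}"
      show ?thesis
      \<comment> \<open>With \<open>\<mu> = 2\<close> the answer 3 clears \<open>v\<close> and the
        depths 1 and 2 of leg \<open>j\<close>: all of that leg that can be reached by one move from
        depth 1.\<close>
      proof (rule free_probe[OF jJ, of 2])
        show "2 < R j" using length_ge[OF jJ] by simp
        show "del x \<le> 2" if "x \<in> N ?T" for x using T[OF that] center by auto
        show "W (N ?T')"
        proof (rule less.hyps)
          show "card (A - {j}) < card A" using j finA by (intro psubset_card_mono) auto
          show "A - {j} \<subset> J" using less.prems(1) by auto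
          have T'V: "?T' \<subseteq> V" using TV by auto
          then show "N ?T' \<subseteq> V" by (rule nbhd_subset)
          have T': "x \<noteq> v \<and> lam x \<in> A - {j} \<and> del x \<le> 2" if "x \<in> ?T'" for x
            using T[of x] that by auto
          show "y = v \<or> lam y \<in> A - {j} \<and> del y \<le> 4" if y: "y \<in> N ?T'" for y
          proof (rule nbhdE[OF y T'V])
            fix x assume x: "x \<in> ?T'" "del y \<le> Suc (del x)" "x \<noteq> v \<Longrightarrow> y \<noteq> v \<Longrightarrow> lam x = lam y"
            have "lam y \<in> A - {j}" if "y \<noteq> v" using T'[OF x(1)] x(3) that by metis
            moreover have "del y \<le> 4" using T'[OF x(1)] x(2) by linarith
            ultimately show ?thesis by blast
          qed
        qed
      qed (use TV in auto)
    qed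
    then show "W S"
      using guard_from_leg[OF i(1) S(1) _ _ S(3)] inA i(2) by metis
  qed
  then show ?case
  proof (rule clear_legs[of "J - A" J A "\<lambda>i. if i \<in> A then 4 else 0" 4])
    show "A \<subseteq> J" using less.prems(1) by (rule psubset_imp_subset)
    show "4 * 3 ^ card A + 2 \<le> R i" if "i \<in> A" for i
    proof -
      have "card A \<le> card J" using \<open>A \<subseteq> J\<close> finite_legs by (rule card_mono[rotated])
      then have "(3::nat) ^ card A \<le> 3 ^ card J" by (intro power_increasing) auto
      then show ?thesis using long[OF subsetD[OF \<open>A \<subseteq> J\<close> that]] by linarith
    qed
    show "bounded J (\<lambda>i. if i \<in> A then 4 else 0) S"
      unfolding bounded_def
    proof (intro conjI ballI impI)
      show "S \<subseteq> V" by (rule less.prems(2))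
      fix x assume "x \<in> S" "x \<noteq> v"
      then have "lam x \<in> A \<and> del x \<le> 4" using less.prems(3) by metis
      then show "del x \<le> (if lam x \<in> A then 4 else 0)" by simp
    qed
    fix S' assume S': "bounded J (\<lambda>_. 0) S'"
    have "x = v" if "x \<in> S'" for x
    proof (rule ccontr)
      assume "x \<noteq> v"
      moreover have "x \<in> V" using S' that by (auto simp: bounded_def)
      ultimately show False
        using S' that leg_in[of x] depth_pos[of x] by (fastforce simp: bounded_def)
    qed
    then have "S' \<subseteq> {v}" by blast
    then show "W S'" by (rule W_center)
  qed (use finA in \<open>auto split: if_splits\<close>)
qed

lemma local_win_nbhd:
  assumes "A \<subset> J" "S \<subseteq> V" "\<And>x. x \<in> S \<Longrightarrow> x \<noteq> v \<and> lam x \<in> A \<and> del x \<le> 3"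
  shows "W (N S)"
proof (rule local_win[OF assms(1) nbhd_subset[OF assms(2)]])
  fix y assume y: "y \<in> N S"
  obtain x where "x \<in> S" "del y \<le> Suc (del x)" "x \<noteq> v \<Longrightarrow> y \<noteq> v \<Longrightarrow> lam x = lam y"
    using nbhdE[OF y assms(2)] by metis
  then show "y = v \<or> lam y \<in> A \<and> del y \<le> 4"
    using assms(3)[of x] by (cases "y = v") auto
qed

text \<open>After an answer 1 or 2 at \<open>v\<close>, a probe at \<open>pt j 2\<close> for an
  arbitrary leg \<open>j\<close> locates the robber or decides whether he is on \<open>j\<close>. He
  is then confined to a proper subset of the legs within depth 3, as \<open>local_win_nbhd\<close>
  demands. Unlike in \<open>guard_from_leg\<close>, no leg has to be clear beforehand.\<close>

lemma guard_center:
  assumes S: "S \<subseteq> V" and rest: "W (N {x \<in> S. 3 \<le> del x})"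
  shows "W S"
proof (cases "J = {}")
  case True
  then have "S \<subseteq> {v}" using S leg_in by blast
  then show ?thesis by (rule W_center)
next
  case False
  then obtain j where j: "j \<in> J" by blast
  have jR: "2 < R j" "Suc 2 < R j" using length_ge[OF j] by auto
  have sub: "J - {j} \<subset> J" using j by auto
  show ?thesis
  proof (rule guard_from_center[OF S _ _ rest])
    let ?T = "{x \<in> S. del x = 1}"
    have TV: "?T \<subseteq> V" using S by auto
    have T: "del y \<le> 2" if y: "y \<in> N ?T" for y
      using nbhdE[OF y TV] by (metis (mono_tags, lifting) mem_Collect_eq numeral_2_eq_2 One_nat_def)
    have T': "y \<in> N ?T \<Longrightarrow> del y \<le> 3" for y using T[of y] by simp
    have "W (N ?T)"
    proof (rule free_probe[OF j, of 2])
      show "W (N {x \<in> N ?T. \<not> ((x = v \<or> lam x = j) \<and> 2 \<le> del x + 2)})"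
        by (rule local_win_nbhd[OF sub]) (use nbhd_subset[OF TV] leg_in T' in auto)
    qed (use jR T nbhd_subset[OF TV] in auto)
    then show "(\<exists>w. ?T \<subseteq> {w}) \<or> W (N ?T)" ..
  next
    let ?T = "{x \<in> S. del x = 2}"
    have TV: "?T \<subseteq> V" using S by auto
    have NV: "N ?T \<subseteq> V" using nbhd_subset[OF TV] .
    have T: "1 \<le> del y \<and> del y \<le> 3" if y: "y \<in> N ?T" for y
    proof -
      obtain x where "x \<in> ?T" "del y \<le> Suc (del x)" "del x \<le> Suc (del y)"
        using nbhdE[OF y TV] by metis
      then show ?thesis by auto
    qed
    have Tv: "y \<noteq> v" if y: "y \<in> N ?T" for y using T[OF y] center by auto
    show "(\<exists>w. ?T \<subseteq> {w}) \<or> W (N ?T)"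
    \<comment> \<open>A single leg would not be a proper subset of \<open>J\<close>, but then depth
      2 already names the vertex.\<close>
    proof (cases "J = {j}")
      case True
      have "?T \<subseteq> {pt j 2}"
      proof
        fix x assume x: "x \<in> ?T"
        then have "x \<in> V" "x \<noteq> v" using S center by auto
        then show "x \<in> {pt j 2}" using eq_ptI[of x j 2] leg_in[of x] True x jR by auto
      qed
      then show ?thesis by blast
    next
      case False
      then have sub': "{j} \<subset> J" using j by auto
      have "W (N ?T)"
      proof (rule probeI)
        show "pt j 2 \<in> V" using pt_pos[OF j _ jR(1)] by simp
        fix r :: nat assume "r \<in> {1, 2, 3}"
        then consider "r = 1" | "r = 2" | "r = 3" by auto
        then show "(\<exists>w. {x \<in> N ?T. near E (pt j 2) x = r} \<subseteq> {w}) \<or> W (N {x \<in> N ?T. near E (pt j 2) x = r})"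
        proof cases
          case 1
          have "x \<noteq> v \<and> lam x \<in> {j} \<and> del x \<le> 3" if "x \<in> {x \<in> N ?T. near E (pt j 2) x = r}" for x
            using near_pt_1[of j 2 x, OF _ j _ jR(1)] that T[of x] Tv[of x] 1 by auto
          then have "W (N {x \<in> N ?T. near E (pt j 2) x = r})"
            by (intro local_win_nbhd[OF sub']) (use NV in auto)
          then show ?thesis ..
        next
          case 2
          \<comment> \<open>At distance 2 from \<open>pt j 2\<close> there are only \<open>v\<close>
            and depth 4 of leg \<open>j\<close>, both impossible one move after depth 2.\<close>
          have "x \<notin> N ?T" if "near E (pt j 2) x = 2" for x
            using near_pt_2[OF that j _ jR(1)] jR(2) T[of x] Tv[of x] subsetD[OF NV, of x] by auto
          then have "{x \<in> N ?T. near E (pt j 2) x = r} \<subseteq> {v}" using 2 by blast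
          then show ?thesis by blast
        next
          case 3
          have "x \<noteq> v \<and> lam x \<in> J - {j} \<and> del x \<le> 3"
            if x: "x \<in> {x \<in> N ?T. near E (pt j 2) x = r}" for x
          proof -
            have xN: "x \<in> N ?T" "near E (pt j 2) x = 3" using x 3 by auto
            have xV: "x \<in> V" "x \<noteq> v" using xN NV Tv by auto
            have "lam x \<noteq> j"
            proof
              assume "lam x = j"
              then show False
                using near_pt_le[OF xN(2) j _ jR(1) xV(1)] jR T[OF xN(1)] by auto
            qed
            then show ?thesis using T[OF xN(1)] xV leg_in[OF xV] by auto
          qed
          then have "W (N {x \<in> N ?T. near E (pt j 2) x = r})"
            by (intro local_win_nbhd[OF sub]) (use NV in auto)
          then show ?thesis ..
        qed
      qed
      then show ?thesis ..
    qed
  qed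
qed

lemma guardable_empty: "guardable {}"
  unfolding guardable_def
proof (intro allI impI)
  fix S assume "S \<subseteq> V" and W: "W (N {x \<in> S. 2 \<le> del x})"
  moreover have "{x \<in> S. 3 \<le> del x} \<subseteq> {x \<in> S. 2 \<le> del x}" by auto
  ultimately show "W S" using guard_center W_mono_nbhd by blast
qed

end

section \<open>Subdivided rooted trees\<close>

text \<open>
  The vertices of the tree are \<open>0, \<dots>, n\<close>, rooted at \<open>0\<close>. In the subdivision, \<open>(a, 0)\<close> is the
  vertex \<open>a\<close> and \<open>(a, i)\<close> is the vertex at distance \<open>i\<close> from it on the path of length \<open>K a\<close> to its
  parent.
\<close>

definition path_verts :: "nat \<Rightarrow> (nat \<Rightarrow> nat) \<Rightarrow> (nat \<times> nat) set" where
  "path_verts n K = insert (0, 0) {(a, i). 0 < a \<and> a \<le> n \<and> i < K a}"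

definition path_up :: "(nat \<Rightarrow> nat) \<Rightarrow> (nat \<Rightarrow> nat) \<Rightarrow> nat \<times> nat \<Rightarrow> nat \<times> nat" where
  "path_up par K = (\<lambda>(a, i). if Suc i < K a then (a, Suc i) else (par a, 0))"

definition path_edges :: "nat \<Rightarrow> (nat \<Rightarrow> nat) \<Rightarrow> (nat \<Rightarrow> nat) \<Rightarrow> ((nat \<times> nat) \<times> nat \<times> nat) set" where
  "path_edges n par K =
     (let U = {(x, path_up par K x) | x. x \<in> path_verts n K \<and> 0 < fst x} in U \<union> U\<inverse>)"

locale rooted_tree =
  fixes n :: nat and par :: "nat \<Rightarrow> nat"
  assumes par_less: "\<And>a. 0 < a \<Longrightarrow> a \<le> n \<Longrightarrow> par a < a"
begin

text \<open>
  The child of \<open>v\<close> through which \<open>a\<close> is reached from \<open>v\<close>, or \<open>v\<close> itself if \<open>a\<close> is not a proper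
  descendant of \<open>v\<close>.
\<close>

function branch :: "nat \<Rightarrow> nat \<Rightarrow> nat" where
  "branch v a = (if a \<le> v \<or> n < a then v else if par a = v then a else branch v (par a))"
  by auto
termination
  by (relation "measure snd") (auto intro: par_less)

declare branch.simps[simp del]

lemma branch_le: "a \<le> v \<Longrightarrow> branch v a = v"
  by (simp add: branch.simps)

lemma branch_child: "0 < a \<Longrightarrow> a \<le> n \<Longrightarrow> branch (par a) a = a"
  using par_less[of a] by (simp add: branch.simps)

lemma branch_up: "a \<le> n \<Longrightarrow> v < a \<Longrightarrow> par a \<noteq> v \<Longrightarrow> branch v a = branch v (par a)"
  by (subst branch.simps) simp

lemma branch_cases:
  assumes "v \<le> n" "a \<le> n"
  shows "branch v a = v \<or> branch v a \<le> a \<and> v < branch v a \<and> branch v a \<le> n \<and> par (branch v a) = v"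
  using assms(2)
proof (induction a rule: less_induct)
  case (less a)
  show ?case
  proof (cases "a \<le> v \<or> par a = v")
    case True
    then have "branch v a = v \<or> v < a \<and> par a = v \<and> branch v a = a"
      using branch_le[of a v] branch_child[of a] less.prems by (cases "a \<le> v") auto
    then show ?thesis using less.prems by auto
  next
    case False
    then have "par a < a" using par_less[of a] less.prems by simp
    moreover have "branch v a = branch v (par a)" using False less.prems by (intro branch_up) auto
    ultimately show ?thesis using less.IH[of "par a"] less.prems by auto
  qed
qed

lemma branch_root: "0 < a \<Longrightarrow> a \<le> n \<Longrightarrow> branch 0 a \<noteq> 0"
proof (induction a rule: less_induct)
  case (less a)
  show ?case
  proof (cases "par a = 0")
    case True
    then show ?thesis using branch_child[of a] less.prems by simp
  next
    case False
    then show ?thesis using less.IH[of "par a"] par_less[of a] branch_up[of a 0] less.prems by simp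
  qed
qed

text \<open>The chain of parents from \<open>a\<close> to \<open>v\<close> passes through
  \<open>c\<close> just before \<open>v\<close>, so from \<open>c\<close> the vertex
  \<open>a\<close> is reached through a child of \<open>c\<close>. Hence whatever is seen through
  \<open>c\<close> from \<open>v\<close>, yet is not below \<open>c\<close>, lies on the path
  between them.\<close>

lemma branch_descendant:
  assumes "branch v a = c" "a \<le> n" "c \<noteq> v" "a \<noteq> c"
  shows "branch c a \<noteq> c"
  using assms(1,2,4)
proof (induction a rule: less_induct)
  case (less a)
  have "v < a" using branch_le[of a v] less.prems(1) assms(3) by (cases "a \<le> v") auto
  moreover have "par a \<noteq> v" using branch_child[of a] less.prems \<open>v < a\<close> by auto
  ultimately have b: "branch v (par a) = c" "par a < a"
    using branch_up[of a v] less.prems par_less[of a] by auto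
  have "v \<le> n" "par a \<le> n" using \<open>v < a\<close> less.prems b by auto
  then have "c \<le> par a" using branch_cases[of v "par a"] b(1) assms(3) by auto
  show ?case
  proof (cases "par a = c")
    case True
    then show ?thesis using branch_child[of a] b less.prems by auto
  next
    case False
    then have "branch c (par a) \<noteq> c" using less.IH[of "par a"] b less.prems by auto
    moreover have "branch c a = branch c (par a)"
      using False b less.prems \<open>c \<le> par a\<close> by (intro branch_up) auto
    ultimately show ?thesis by simp
  qed
qed

section \<open>Legs of a tree vertex, their lengths and depths\<close>

definition children :: "nat \<Rightarrow> nat set" where
  "children v = {c. 0 < c \<and> c \<le> n \<and> par c = v}"

text \<open>The leg to the parent is labelled \<open>v\<close> and the leg to a child by that child,
  so the length of a leg is \<open>K\<close> of its label in both cases.\<close>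

definition legs :: "nat \<Rightarrow> nat set" where
  "legs v = children v \<union> (if v = 0 then {} else {v})"

lemma legs_subset: "v \<le> n \<Longrightarrow> legs v \<subseteq> {1..n}"
  by (auto simp: legs_def children_def)

text \<open>
  The factor \<open>3 ^ n + 1\<close> makes a leg longer than \<open>3 ^ n * K b\<close> for each later vertex \<open>b\<close>, the time in
  which the subtree of \<open>b\<close>, its leg and the legs of all earlier siblings are cleared, and even
  longer than the sum of these times.
\<close>

definition K :: "nat \<Rightarrow> nat" where
  "K a = (4 * 3 ^ Suc n + 2) * (3 ^ n + 1) ^ (n - a)"

lemma K_ge: "4 * 3 ^ Suc n + 2 \<le> K a"
proof -
  have "1 \<le> (3 ^ n + 1 :: nat) ^ (n - a)" by simp
  from mult_le_mono2[OF this, of "4 * 3 ^ Suc n + 2"] show ?thesis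
    unfolding K_def by (simp only: mult_1_right)
qed

lemma K_pos: "0 < K a"
  using K_ge[of a] by simp

lemma K_Suc: "a < n \<Longrightarrow> K a = (3 ^ n + 1) * K (Suc a)"
proof -
  assume "a < n"
  then have "n - a = Suc (n - Suc a)" by simp
  then show "K a = (3 ^ n + 1) * K (Suc a)"
    unfolding K_def by (simp only: power_Suc mult.left_commute)
qed

lemma K_antimono: "a \<le> b \<Longrightarrow> b \<le> n \<Longrightarrow> K b \<le> K a"
  unfolding K_def by (intro mult_le_mono2 power_increasing) auto

lemma K_step:
  assumes "a < b" "b \<le> n"
  shows "3 ^ n * K b + 2 \<le> K a"
proof -
  have "3 ^ n * K b + 2 \<le> (3 ^ n + 1) * K b" using K_ge[of b] by simp
  also have "\<dots> \<le> (3 ^ n + 1) * K (Suc a)" using assms by (intro mult_le_mono2 K_antimono) auto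
  also have "\<dots> = K a" using assms K_Suc[of a] by simp
  finally show ?thesis .
qed

lemma K_sum:
  assumes "v \<le> n" shows "(\<Sum>c = Suc v..n. 3 ^ n * K c) + 1 \<le> K v"
  using assms
proof (induction v rule: inc_induct)
  case base
  then show ?case using K_pos[of n] by simp
next
  case (step v)
  have "(\<Sum>c = Suc v..n. 3 ^ n * K c) = 3 ^ n * K (Suc v) + (\<Sum>c = Suc (Suc v)..n. 3 ^ n * K c)"
    using step.hyps by (subst sum.atLeast_Suc_atMost) auto
  then show ?case using step.IH K_Suc[of v] step.hyps by simp
qed

definition V :: "(nat \<times> nat) set" where "V = path_verts n K"
definition E :: "((nat \<times> nat) \<times> nat \<times> nat) set" where "E = path_edges n par K"

definition leg :: "nat \<Rightarrow> nat \<times> nat \<Rightarrow> nat" where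
  "leg v x = branch v (fst x)"

text \<open>The distance from \<open>(v, 0)\<close>, cut off at the length of the leg: the second
  and fourth cases are the vertices beyond the parent path and below a child, where
  \<open>spider\<close> allows a constant.\<close>

definition depth :: "nat \<Rightarrow> nat \<times> nat \<Rightarrow> nat" where
  "depth v x = (if fst x = v then snd x else if leg v x = v then K v
     else if fst x = leg v x then K (leg v x) - snd x else K (leg v x))"

lemma V_iff: "(a, i) \<in> V \<longleftrightarrow> a \<le> n \<and> (if a = 0 then i = 0 else i < K a)"
  by (auto simp: V_def path_verts_def)

lemma E_cases:
  assumes "(x, y) \<in> E"
  obtains (inner) a i where "0 < a" "a \<le> n" "Suc i < K a" "{x, y} = {(a, i), (a, Suc i)}"
    | (outer) a where "0 < a" "a \<le> n" "{x, y} = {(a, K a - 1), (par a, 0)}"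
proof -
  obtain a i where ai: "(a, i) \<in> V" "0 < a" "{x, y} = {(a, i), path_up par K (a, i)}"
    using assms by (fastforce simp: E_def path_edges_def V_def Let_def)
  then have "a \<le> n" "i < K a" by (auto simp: V_iff split: if_splits)
  then show thesis
  proof (cases "Suc i < K a")
    case True
    then show thesis using inner[of a i] ai \<open>a \<le> n\<close> by (simp add: path_up_def)
  next
    case False
    then have "i = K a - 1" using \<open>i < K a\<close> by simp
    then show thesis using outer[of a] ai \<open>a \<le> n\<close> False by (simp add: path_up_def)
  qed
qed

lemma E_up: "x \<in> V \<Longrightarrow> 0 < fst x \<Longrightarrow> (x, path_up par K x) \<in> E"
  unfolding E_def path_edges_def Let_def V_def by blast

lemma E_inner: "0 < a \<Longrightarrow> a \<le> n \<Longrightarrow> Suc i < K a \<Longrightarrow> ((a, i), (a, Suc i)) \<in> E"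
  using E_up[of "(a, i)"] by (simp add: V_iff path_up_def)

lemma E_outer: "0 < a \<Longrightarrow> a \<le> n \<Longrightarrow> ((a, K a - 1), (par a, 0)) \<in> E"
  using E_up[of "(a, K a - 1)"] K_pos[of a] by (simp add: V_iff path_up_def)

lemma E_sym: "sym E"
  by (auto simp: E_def path_edges_def Let_def sym_def)

lemma E_V: "E \<subseteq> V \<times> V"
proof
  fix e assume e: "e \<in> E"
  obtain x y where xy: "e = (x, y)" by (cases e)
  have "{x, y} \<subseteq> V"
    using e unfolding xy
  proof (cases rule: E_cases)
    case (inner a i)
    then show ?thesis by (auto simp: V_iff)
  next
    case (outer a)
    have "(a, K a - 1) \<in> V" "(par a, 0) \<in> V"
      using outer K_pos par_less[of a] by (auto simp: V_iff)
    then show ?thesis using outer by simp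
  qed
  then show "e \<in> V \<times> V" using xy by simp
qed

lemma depth_edge:
  assumes "(x, y) \<in> E" "v \<le> n"
  shows "x \<noteq> (v, 0) \<Longrightarrow> y \<noteq> (v, 0) \<Longrightarrow> leg v x = leg v y"
    and "depth v y = Suc (depth v x) \<or> depth v x = Suc (depth v y) \<or>
      depth v x = depth v y \<and> K (leg v x) \<le> depth v x"
    and "x = (v, 0) \<Longrightarrow> depth v y = 1"
proof -
  \<comment> \<open>Symmetric in \<open>x\<close> and \<open>y\<close>, so that each edge is checked
    in one orientation only.\<close>
  define good where "good x y \<longleftrightarrow> (x \<noteq> (v, 0) \<longrightarrow> y \<noteq> (v, 0) \<longrightarrow> leg v x = leg v y) \<and>
    (depth v y = Suc (depth v x) \<or> depth v x = Suc (depth v y) \<or>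
      depth v x = depth v y \<and> K (leg v x) \<le> depth v x \<and> K (leg v y) \<le> depth v x) \<and>
    (x = (v, 0) \<longrightarrow> depth v y = 1) \<and> (y = (v, 0) \<longrightarrow> depth v x = 1)" for x y
  have sym: "good x y \<Longrightarrow> good y x" for x y by (auto simp: good_def)
  have "good x y"
    using assms(1)
  proof (cases rule: E_cases)
    case (inner a i)
    have "good (a, i) (a, Suc i)"
      using inner by (auto simp: good_def depth_def leg_def)
    then show ?thesis using inner(4) sym by (auto simp: doubleton_eq_iff)
  next
    case (outer a)
    have K1: "1 < K a" using K_ge[of a] by simp
    note pl = par_less[OF outer(1,2)]
    have "good (a, K a - 1) (par a, 0)"
    proof (cases "a \<le> v")
      case True
      then have "branch v a = v" "branch v (par a) = v" "par a \<noteq> v" using pl by (auto simp: branch_le)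
      then show ?thesis using K1 by (auto simp: good_def depth_def leg_def)
    next
      case False
      show ?thesis
      proof (cases "par a = v")
        case True
        then have "branch v a = a" "a \<noteq> v" using branch_child[OF outer(1,2)] False by auto
        then show ?thesis using True K1 by (auto simp: good_def depth_def leg_def)
      next
        case par: False
        have eq: "branch v a = branch v (par a)" using False par outer by (intro branch_up) auto
        have "branch v (par a) \<noteq> a"
          using branch_cases[OF assms(2), of "par a"] pl outer(2) False by auto
        then show ?thesis using eq par False by (auto simp: good_def depth_def leg_def)
      qed
    qed
    then show ?thesis using outer(3) sym by (auto simp: doubleton_eq_iff)
  qed
  then show "x \<noteq> (v, 0) \<Longrightarrow> y \<noteq> (v, 0) \<Longrightarrow> leg v x = leg v y"
    "depth v y = Suc (depth v x) \<or> depth v x = Suc (depth v y) \<or>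
      depth v x = depth v y \<and> K (leg v x) \<le> depth v x"
    "x = (v, 0) \<Longrightarrow> depth v y = 1"
    by (auto simp: good_def)
qed

text \<open>A depth below the length of the leg is not a cut-off value, so the vertex is on the leg
  itself and its coordinates can be read off.\<close>

lemma depth_less:
  assumes "(a, i) \<in> V" "depth v (a, i) < K (leg v (a, i))" "v \<le> n"
  shows "a = leg v (a, i)" "a = v \<Longrightarrow> depth v (a, i) = i"
    "a \<noteq> v \<Longrightarrow> depth v (a, i) = K a - i \<and> par a = v \<and> 0 < a \<and> a \<le> n \<and> 0 < i \<and> i < K a"
proof -
  have a: "a \<le> n" "a \<noteq> 0 \<Longrightarrow> i < K a" using assms(1) by (auto simp: V_iff split: if_splits)
  show *: "a = leg v (a, i)"
    using assms(2) by (auto simp: depth_def leg_def branch_le split: if_splits)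
  show "a = v \<Longrightarrow> depth v (a, i) = i" by (simp add: depth_def)
  assume av: "a \<noteq> v"
  then have l: "leg v (a, i) \<noteq> v" using * by simp
  then have d: "depth v (a, i) = K a - i" using av * by (simp add: depth_def)
  have "par a = v \<and> 0 < a"
    using branch_cases[OF assms(3) a(1)] * l by (auto simp: leg_def)
  then show "depth v (a, i) = K a - i \<and> par a = v \<and> 0 < a \<and> a \<le> n \<and> 0 < i \<and> i < K a"
    using d a assms(2) * by (cases "i = 0") auto
qed

lemma leg_in_legs:
  assumes "x \<in> V" "x \<noteq> (v, 0)" "v \<le> n"
  shows "leg v x \<in> legs v"
proof (cases "leg v x = v")
  case True
  have "v \<noteq> 0"
  proof
    assume "v = 0"
    then have "fst x \<noteq> 0" using assms by (cases x) (auto simp: V_iff split: if_splits)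
    then show False using branch_root[of "fst x"] True assms \<open>v = 0\<close>
      by (cases x) (auto simp: V_iff leg_def)
  qed
  then show ?thesis using True by (simp add: legs_def)
next
  case False
  have "fst x \<le> n" using assms(1) by (cases x) (auto simp: V_iff)
  from branch_cases[OF assms(3) this] False show ?thesis
    by (auto simp: legs_def children_def leg_def)
qed

lemma spider_at:
  assumes v: "v \<le> n"
  shows "spider V E (v, 0) (leg v) (depth v) (legs v) K"
proof
  show "finite (legs v)" using finite_subset[OF legs_subset[OF v]] by simp
  show "(v, 0) \<in> V" using v K_pos by (simp add: V_iff)
  show "depth v (v, 0) = 0" by (simp add: depth_def)
  show "E \<subseteq> V \<times> V" "sym E" by (rule E_V, rule E_sym)
  show "0 < depth v x" if "x \<in> V" "x \<noteq> (v, 0)" for x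
    using that K_pos by (cases x) (auto simp: depth_def leg_def branch_le V_iff split: if_splits)
  show "leg v x \<in> legs v" if "x \<in> V" "x \<noteq> (v, 0)" for x using leg_in_legs[OF that v] .
  show "leg v x = leg v y" if "(x, y) \<in> E" "x \<noteq> (v, 0)" "y \<noteq> (v, 0)" for x y
    using depth_edge(1)[OF that(1) v that(2,3)] .
  show "depth v y = Suc (depth v x) \<or> depth v x = Suc (depth v y) \<or>
      depth v x = depth v y \<and> K (leg v x) \<le> depth v x" if "(x, y) \<in> E" for x y
    using depth_edge(2)[OF that v] .
  show "depth v y = 1" if "((v, 0), y) \<in> E" for y
    using depth_edge(3)[OF that v] by simp
  show "x = y" if "x \<in> V" "y \<in> V" "leg v x = leg v y" "depth v x = depth v y"
    "depth v x < K (leg v x)" for x y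
  proof -
    obtain a i b j where ab: "x = (a, i)" "y = (b, j)" by (cases x, cases y) auto
    have dy: "depth v y < K (leg v y)" using that by simp
    note dx = depth_less[OF that(1)[unfolded ab] that(5)[unfolded ab] v]
    note dy = depth_less[OF that(2)[unfolded ab] dy[unfolded ab] v]
    have "a = b" using dx(1) dy(1) that(3) unfolding ab by simp
    moreover have "i = j"
      using dx(2,3) dy(2,3) \<open>a = b\<close> that(4) unfolding ab by (cases "a = v") auto
    ultimately show ?thesis using ab by simp
  qed
  show "\<exists>x\<in>V. x \<noteq> (v, 0) \<and> leg v x = j \<and> depth v x = i" if "j \<in> legs v" "0 < i" "i < K j" for j i
  proof (cases "j = v")
    case True
    then have "v \<noteq> 0" using that(1) by (auto simp: legs_def children_def split: if_splits)
    then show ?thesis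
      using that v True by (intro bexI[of _ "(v, i)"]) (auto simp: V_iff leg_def depth_def branch_le)
  next
    case False
    then have j: "0 < j" "j \<le> n" "par j = v" using that(1) by (auto simp: legs_def children_def split: if_splits)
    then have "branch v j = j" using branch_child[of j] by simp
    then show ?thesis using that j False
      by (intro bexI[of _ "(j, K j - i)"]) (auto simp: V_iff leg_def depth_def)
  qed
  show "\<exists>y\<in>V. (y, x) \<in> E \<and> Suc (depth v y) = depth v x"
    if x: "x \<in> V" "x \<noteq> (v, 0)" "depth v x < K (leg v x)" for x
  proof -
    obtain a i where ai: "x = (a, i)" by (cases x)
    note d = depth_less[OF x(1)[unfolded ai] x(3)[unfolded ai] v]
    show ?thesis
    proof (cases "a = v")
      case True
      then have i: "0 < i" using x ai by auto
      then have "0 < a" "a \<le> n" "i < K a" using x(1) ai by (auto simp: V_iff split: if_splits)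
      then have "((a, i - 1), (a, i)) \<in> E" "(a, i - 1) \<in> V"
        using E_inner[of a "i - 1"] i by (auto simp: V_iff)
      then show ?thesis
        using True ai i by (intro bexI[of _ "(a, i - 1)"]) (auto simp: depth_def)
    next
      case False
      note d3 = d(3)[OF False]
      show ?thesis
      proof (cases "Suc i < K a")
        case True
        have "((a, Suc i), (a, i)) \<in> E" "(a, Suc i) \<in> V"
          using E_inner[of a i] True d3 E_sym by (auto simp: V_iff dest: symD)
        moreover have "Suc (depth v (a, Suc i)) = depth v (a, i)"
          using d3 d(1) False True by (auto simp: depth_def leg_def)
        ultimately show ?thesis using ai by blast
      next
        case F: False
        then have "i = K a - 1" using d3 by auto
        then have "((v, 0), (a, i)) \<in> E" using E_outer[of a] d3 E_sym by (auto dest: symD)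
        moreover have "(v, 0) \<in> V" using v K_pos by (simp add: V_iff)
        moreover have "Suc (depth v (v, 0)) = depth v (a, i)"
          using d3 F by (auto simp: depth_def[of v "(v, 0)"])
        ultimately show ?thesis using ai by blast
      qed
    qed
  qed
  show "4 * 3 ^ card (legs v) + 2 \<le> K j" for j
  proof -
    have "card (legs v) \<le> Suc n"
      using card_mono[OF _ legs_subset[OF v]] by simp
    then have "(3::nat) ^ card (legs v) \<le> 3 ^ Suc n" by (intro power_increasing) auto
    then show ?thesis using K_ge[of j] by linarith
  qed
qed

section \<open>Clearing subtrees from the leaves to the root\<close>

definition outside :: "nat \<Rightarrow> (nat \<times> nat) set" where
  "outside v = {x \<in> V. leg v x = v \<and> 2 \<le> depth v x}"

text \<open>Such a vertex is on the path from \<open>c\<close> to its parent by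
  \<open>branch_descendant\<close>. The margin of 2 at the end near \<open>c\<close> gives the
  condition \<open>m j + 1 < R j\<close> of \<open>clear_leg\<close>.\<close>

lemma outside_depth:
  assumes "x \<in> outside c" "0 < c" "c \<le> n" "leg (par c) x = c"
  shows "depth (par c) x \<le> K c - 2"
proof -
  obtain a i where ai: "x = (a, i)" by (cases x)
  have x: "branch c a = c" "a \<le> n" "2 \<le> depth c x" using assms(1) ai by (auto simp: outside_def leg_def V_iff)
  have "c \<noteq> par c" using par_less[OF assms(2,3)] by simp
  then have "a = c" using branch_descendant[of "par c" a c] x assms(4) ai by (auto simp: leg_def)
  then show ?thesis using x(3) assms(4) \<open>c \<noteq> par c\<close> ai by (auto simp: depth_def leg_def)
qed

text \<open>
  The children of \<open>v\<close> are processed in increasing order. While the subtree of the child \<open>c\<close> is being cleared, the robber re-enters the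
  legs of earlier children, but these are much longer than the time which this takes, and they can
  be cleared once the subtree of \<open>c\<close> and its leg are.
\<close>

lemma clear_subtree:
  assumes "v \<le> n" "S \<subseteq> V"
    and "\<And>S'. S' \<subseteq> (nbhd E ^^ K v) S \<Longrightarrow> S' \<subseteq> outside v \<Longrightarrow> winning V E S'"
  shows "winning V E S"
  using assms
proof (induction "n - v" arbitrary: v S rule: less_induct)
  case less
  interpret sp: spider V E "(v, 0)" "leg v" "depth v" "legs v" K
    using less.prems(1) by (rule spider_at)
  \<comment> \<open>Time allotted to the children below \<open>b\<close>. Summing over all numbers,
    children or not, makes \<open>K_sum\<close> applicable.\<close>
  define T where "T b = (\<Sum>c = Suc v..<b. 3 ^ n * K c)" for b
  define before where "before b = {c \<in> children v. c < b}" for b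
  have children: "winning V E S"
    if "b \<le> Suc n" "Suc v \<le> b" "S \<subseteq> V"
      "\<And>S'. S' \<subseteq> (nbhd E ^^ T b) S \<Longrightarrow> sp.bounded (before b) (\<lambda>_. 0) S' \<Longrightarrow> winning V E S'" for b S
    using that(2,1,3,4)
  proof (induction b arbitrary: S rule: dec_induct)
    case base
    have "v < c" if "c \<in> children v" for c using par_less[of c] that by (auto simp: children_def)
    then have "before (Suc v) = {}" by (force simp: before_def)
    then have "sp.bounded (before (Suc v)) (\<lambda>_. 0) S" using base by (simp add: sp.bounded_def)
    then show ?case using base(3)[of S] by (simp add: T_def)
  next
    case (step c)
    have T: "T (Suc c) = T c + 3 ^ n * K c" using step.hyps by (simp add: T_def)
    show ?case
    proof (rule step.IH)
      show "c \<le> Suc n" "S \<subseteq> V" using step.prems by auto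
      fix S1 assume S1: "S1 \<subseteq> (nbhd E ^^ T c) S" "sp.bounded (before c) (\<lambda>_. 0) S1"
      show "winning V E S1"
      proof (cases "c \<in> children v")
        case False
        then have "before (Suc c) = before c" by (auto simp: before_def less_Suc_eq)
        moreover have "S1 \<subseteq> (nbhd E ^^ T (Suc c)) S"
          using funpow_nbhd_mono_time[of "T c" "T (Suc c)"] S1(1) T by fastforce
        ultimately show ?thesis using step.prems(3) S1(2) by simp
      next
        case True
        then have c: "0 < c" "c \<le> n" "par c = v" by (auto simp: children_def)
        let ?B = "before c"
        have B': "before (Suc c) = insert c ?B" using True by (auto simp: before_def less_Suc_eq)
        have B: "finite ?B" "c \<notin> ?B" "insert c ?B \<subseteq> legs v" "insert c ?B \<subseteq> {1..n}"
          using True by (auto simp: before_def children_def legs_def)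
        have "card (insert c ?B) \<le> n" using card_mono[OF _ B(4)] by simp
        \<comment> \<open>One factor 3 is for clearing leg \<open>c\<close>, the others for the legs
          of its earlier siblings.\<close>
        then have pow: "3 * 3 ^ card ?B \<le> (3::nat) ^ n"
          using power_increasing[of "Suc (card ?B)" n "3::nat"] B by simp
        have "(0::nat) < 3 ^ Suc n" by simp
        then have K2: "2 < K c" using K_ge[of c] by linarith
        show ?thesis
        proof (rule less.hyps[of c])
          show "n - c < n - v" using c par_less[of c] by auto
          show "c \<le> n" by fact
          show "S1 \<subseteq> V" using S1(2) by (simp add: sp.bounded_def)
          fix S2 assume S2: "S2 \<subseteq> (nbhd E ^^ K c) S1" "S2 \<subseteq> outside c"
          \<comment> \<open>In the \<open>K c\<close> rounds spent on the subtree of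
            \<open>c\<close>, the clear legs of earlier siblings fill up to depth at most
            \<open>K c\<close>.\<close>
          define m where "m i = (if i = c then K c - 2 else K c)" for i
          have "sp.bounded ?B (\<lambda>i. 0 + K c) ((nbhd E ^^ K c) S1)"
            using sp.bounded_funpow_nbhd[OF S1(2)] .
          then have NV: "(nbhd E ^^ K c) S1 \<subseteq> V"
            and Nm: "\<And>x. x \<in> (nbhd E ^^ K c) S1 \<Longrightarrow> x \<noteq> (v, 0) \<Longrightarrow> leg v x \<in> ?B \<Longrightarrow> depth v x \<le> K c"
            by (auto simp: sp.bounded_def)
          have bd2: "sp.bounded (insert c ?B) m S2"
            unfolding sp.bounded_def
          proof (intro conjI ballI impI)
            show "S2 \<subseteq> V" using S2(1) NV by (rule subset_trans)
            fix x assume x: "x \<in> S2" "x \<noteq> (v, 0)" "leg v x \<in> insert c ?B"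
            show "depth v x \<le> m (leg v x)"
            proof (cases "leg v x = c")
              case True
              then show ?thesis
                using outside_depth[OF subsetD[OF S2(2) x(1)] c(1,2)] c(3) by (simp add: m_def)
            next
              case False
              then show ?thesis using Nm[OF subsetD[OF S2(1) x(1)] x(2)] x(3) by (simp add: m_def)
            qed
          qed
          show "winning V E S2"
          \<comment> \<open>Leg \<open>c\<close> has to come first, because its contamination has no
            room to grow; the legs of earlier siblings have length at least
            \<open>3 ^ n * K c + 2\<close>. No leg is known to be clear here, so \<open>v\<close> is
            guarded by \<open>guardable_empty\<close>.\<close>
          proof (rule sp.clear_leg[OF sp.guardable_empty _ _ _ B(3) _ bd2])
            show "m c + 1 < K c" using K2 by (simp add: m_def)
            fix S3 assume S3: "S3 \<subseteq> (nbhd E ^^ (2 * m c)) S2"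
              "sp.bounded (insert c ?B) (\<lambda>i. if i = c \<or> m i = 0 then 0 else m i + 2 * m c) S3"
            define m3 where "m3 i = (if i = c then 0 else 3 * K c)" for i
            have bd3: "sp.bounded (insert c ?B) m3 S3"
              by (rule sp.bounded_mono[OF S3(2)]) (auto simp: m_def m3_def)
            show "winning V E S3"
            proof (rule sp.clear_legs[OF sp.guardable_empty _ B(3,1) _ _ _ _ _ bd3, of "3 * K c"])
              show "3 * K c * 3 ^ card ?B + 2 \<le> K i" if "i \<in> ?B" for i
              proof -
                have "3 * K c * 3 ^ card ?B \<le> 3 ^ n * K c"
                  using mult_le_mono1[OF pow, of "K c"] by (simp add: mult_ac)
                moreover have "3 ^ n * K c + 2 \<le> K i"
                  using K_step[of i c] that c by (simp add: before_def)
                ultimately show ?thesis by linarith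
              qed
              fix S4 assume S4: "S4 \<subseteq> (nbhd E ^^ ((3 ^ card ?B - 1) * (3 * K c))) S3"
                "sp.bounded (insert c ?B) (\<lambda>_. 0) S4"
              obtain q where q: "3 ^ card ?B = Suc q"
                by (metis not0_implies_Suc power_not_zero zero_neq_numeral)
              have "K c + 2 * m c + (3 ^ card ?B - 1) * (3 * K c) \<le> 3 * 3 ^ card ?B * K c"
                using q by (simp add: m_def algebra_simps)
              also have "\<dots> \<le> 3 ^ n * K c" using pow by (rule mult_le_mono1)
              finally have "T c + (K c + (2 * m c + (3 ^ card ?B - 1) * (3 * K c))) \<le> T (Suc c)"
                using T by simp
              then have "S4 \<subseteq> (nbhd E ^^ T (Suc c)) S"
                using funpow_nbhd_add[OF S1(1) funpow_nbhd_add[OF S2(1)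
                    funpow_nbhd_add[OF S3(1) S4(1) order_refl] order_refl]] by blast
              then show "winning V E S4" using S4(2) B' by (intro step.prems(3)) simp_all
            qed (auto simp: m3_def)
          qed auto
        qed
      qed
    qed
  qed
  show ?case
  proof (rule children[of "Suc n"])
    show "Suc n \<le> Suc n" "Suc v \<le> Suc n" "S \<subseteq> V" using less.prems by auto
    fix S' assume S': "S' \<subseteq> (nbhd E ^^ T (Suc n)) S" "sp.bounded (before (Suc n)) (\<lambda>_. 0) S'"
    have S'V: "S' \<subseteq> V" using S'(2) by (simp add: sp.bounded_def)
    let ?S = "{x \<in> S'. 3 \<le> depth v x}"
    have leg: "leg v x = v" if "x \<in> ?S" for x
    proof (rule ccontr)
      assume "leg v x \<noteq> v"
      have x: "x \<in> V" "x \<noteq> (v, 0)" using that S'V by (auto simp: depth_def)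
      then have "leg v x \<in> before (Suc n)"
        using leg_in_legs[OF x less.prems(1)] \<open>leg v x \<noteq> v\<close>
        by (auto simp: legs_def before_def children_def split: if_splits)
      then show False using S'(2) that x by (fastforce simp: sp.bounded_def)
    qed
    show "winning V E S'"
    \<comment> \<open>The guard leaves depth at least 3, hence at least 2 after the move, as
      \<open>outside\<close> demands. This move is the \<open>+ 1\<close> in
      \<open>K_sum\<close>.\<close>
    proof (rule sp.guard_center[OF S'V], rule less.prems(3))
      have "T (Suc n) + 1 \<le> K v"
        using K_sum[OF less.prems(1)] by (simp add: T_def atLeastLessThanSuc_atLeastAtMost)
      moreover have "nbhd E ?S \<subseteq> (nbhd E ^^ 1) S'" using nbhd_mono[of ?S S'] by simp
      ultimately show "nbhd E ?S \<subseteq> (nbhd E ^^ K v) S"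
        using funpow_nbhd_add[OF S'(1)] by blast
      show "nbhd E ?S \<subseteq> outside v"
      proof
        fix y assume y: "y \<in> nbhd E ?S"
        have "?S \<subseteq> V" using S'V by auto
        from y this show "y \<in> outside v"
        proof (rule sp.nbhdE)
          fix x assume x: "x \<in> ?S" "y \<in> V" "depth v x \<le> Suc (depth v y)"
            "x \<noteq> (v, 0) \<Longrightarrow> y \<noteq> (v, 0) \<Longrightarrow> leg v x = leg v y"
          then have d: "2 \<le> depth v y" by auto
          then have "x \<noteq> (v, 0)" "y \<noteq> (v, 0)" using x(1) by (auto simp: depth_def)
          then have "leg v y = v" using x(4) leg[OF x(1)] by simp
          then show ?thesis using x(2) d by (simp add: outside_def)
        qed
      qed
    qed
  qed
qed

text \<open>The root has no leg to a parent, so \<open>outside 0\<close> is empty and clearing its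
  subtree leaves no candidate.\<close>

lemma winning_path_tree: "winning (path_verts n K) (path_edges n par K) (path_verts n K)"
proof -
  have "winning V E V"
  proof (rule clear_subtree[of 0])
    fix S' assume "S' \<subseteq> outside 0"
    moreover have "outside 0 = {}"
    proof (rule ccontr)
      assume "outside 0 \<noteq> {}"
      then obtain x where x: "x \<in> V" "leg 0 x = 0" "2 \<le> depth 0 x" by (auto simp: outside_def)
      then have "x \<noteq> (0, 0)" by (auto simp: depth_def)
      then show False using leg_in_legs[OF x(1), of 0] x(2) by (auto simp: legs_def children_def)
    qed
    ultimately have "S' \<subseteq> {(0, 0)}" by simp
    then show "winning V E S'" by (intro winning_subsingleton[of "(0, 0)"]) (simp_all add: V_iff)
  qed auto
  then show ?thesis by (simp add: V_def E_def)
qed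

end

section \<open>Subdivisions of a tree\<close>

definition tree_arcs :: "nat \<Rightarrow> (nat \<Rightarrow> nat) \<Rightarrow> (nat \<Rightarrow> 'a) \<Rightarrow> ('a \<times> 'a) set" where
  "tree_arcs n par f = (let U = {(f a, f (par a)) | a. 0 < a \<and> a \<le> n} in U \<union> U\<inverse>)"

context pair_graph
begin

lemma arc_sym: "(x, y) \<in> parcs G \<Longrightarrow> (y, x) \<in> parcs G"
  using pair_sym_arcs by (auto simp: symmetric_def sym_def)

lemma crossing_arc:
  assumes "Digraph_Component.connected (with_proj G)"
    and "S \<subset> pverts G" "S \<noteq> {}"
  obtains x y where "x \<in> S" "y \<in> pverts G - S" "(x, y) \<in> parcs G"
proof -
  obtain u w where uw: "u \<in> S" "w \<in> pverts G" "w \<notin> S" using assms(2,3) by blast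
  have arcs: "parcs (mk_symmetric (with_proj G)) = parcs G"
    unfolding mk_symmetric_def using arc_sym by auto
  have "\<forall>u\<in>pverts G. \<forall>v\<in>pverts G. reachable (with_proj (mk_symmetric (with_proj G))) u v"
    using assms(1) unfolding connected_def strongly_connected_def by simp
  then have "reachable (with_proj (mk_symmetric (with_proj G))) u w"
    using uw assms(2) by blast
  from rtrancl_on_rtranclI[OF this[unfolded reachable_def]]
  have "(u, w) \<in> (parcs G)\<^sup>*" by (simp add: arcs)
  then have "\<exists>x y. x \<in> S \<and> y \<in> pverts G - S \<and> (x, y) \<in> parcs G"
    using uw(3)
  proof (induction rule: rtrancl_induct)
    case base
    then show ?case using uw(1) by simp
  next
    case (step y z)
    then show ?case using in_arcsD2[of y z] by (cases "y \<in> S") auto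
  qed
  then show thesis using that by blast
qed

text \<open>A vertex set grows along arcs that leave it; the inner end of the arc becomes the parent
  of the new vertex and thus has a smaller number.\<close>

lemma numbering:
  assumes "Digraph_Component.connected (with_proj G)" "m < card (pverts G)"
  shows "\<exists>f par. inj_on f {..m} \<and> f ` {..m} \<subseteq> pverts G \<and>
    (\<forall>a. 0 < a \<and> a \<le> m \<longrightarrow> par a < a \<and> (f a, f (par a)) \<in> parcs G)"
  using assms(2)
proof (induction m)
  case 0
  then obtain r where "r \<in> pverts G" by (metis card_gt_0_iff ex_in_conv)
  then show ?case by (intro exI[of _ "\<lambda>_. r"]) auto
next
  case (Suc m)
  then obtain f par where f: "inj_on f {..m}" "f ` {..m} \<subseteq> pverts G"
    and par: "\<And>a. 0 < a \<Longrightarrow> a \<le> m \<Longrightarrow> par a < a \<and> (f a, f (par a)) \<in> parcs G"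
    using Suc_lessD[OF Suc.prems] by metis
  have "card (f ` {..m}) = Suc m" using f(1) by (simp add: card_image)
  then have "f ` {..m} \<subset> pverts G" using f(2) Suc.prems by auto
  from crossing_arc[OF assms(1) this] obtain x y
    where xy: "x \<in> f ` {..m}" "y \<in> pverts G - f ` {..m}" "(x, y) \<in> parcs G" by blast
  then obtain b where b: "b \<le> m" "x = f b" by auto
  define f' where "f' = f(Suc m := y)"
  define par' where "par' = par(Suc m := b)"
  have "inj_on f' {..Suc m}"
    using f(1) xy(2) by (auto simp: f'_def inj_on_def atMost_Suc)
  moreover have "f' ` {..Suc m} \<subseteq> pverts G"
    using f(2) xy(2) by (auto simp: f'_def atMost_Suc)
  moreover have "par' a < a \<and> (f' a, f' (par' a)) \<in> parcs G" if a: "0 < a" "a \<le> Suc m" for a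
  proof (cases "a = Suc m")
    case True
    then show ?thesis using b arc_sym[OF xy(3)] by (simp add: f'_def par'_def)
  next
    case False
    then show ?thesis using par[of a] a by (auto simp: f'_def par'_def)
  qed
  ultimately show ?case by blast
qed

text \<open>Tree arcs join any two vertices through \<open>f 0\<close>, so a further arc would close
  a cycle. Its length is at least 3, since a joining path of length 1 would be the reverse of that
  arc, and \<open>tree_arcs\<close> is symmetric.\<close>

lemma tree_arcs_eq_if_acyclic:
  assumes acyclic: "\<not> (\<exists>p. cycle p \<and> 3 \<le> length p)"
    and f: "f ` {..n} = pverts G"
    and par: "\<And>a. 0 < a \<Longrightarrow> a \<le> n \<Longrightarrow> par a < a \<and> (f a, f (par a)) \<in> parcs G"
  shows "parcs G = tree_arcs n par f"
proof
  define H where "H = \<lparr>pverts = pverts G, parcs = tree_arcs n par f\<rparr>"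
  show sub: "tree_arcs n par f \<subseteq> parcs G"
    using par arc_sym by (auto simp: tree_arcs_def Let_def)
  interpret H: pair_wf_digraph H
  proof
    show "fst e \<in> pverts H" "snd e \<in> pverts H" if "e \<in> parcs H" for e
      using that sub arc_fst_in_verts[of e] arc_snd_in_verts[of e] by (auto simp: H_def)
  qed
  have up: "(f a, f (par a)) \<in> parcs H" "(f (par a), f a) \<in> parcs H" if "0 < a" "a \<le> n" for a
    using that by (auto simp: H_def tree_arcs_def Let_def)
  have root: "reachable (with_proj H) (f a) (f 0) \<and> reachable (with_proj H) (f 0) (f a)"
    if "a \<le> n" for a
    using that
  proof (induction a rule: less_induct)
    case (less a)
    show ?case
    proof (cases "a = 0")
      case True
      have "f 0 \<in> pverts H" using f by (auto simp: H_def)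
      then show ?thesis using True H.reachable_refl by simp
    next
      case False
      then have a: "0 < a" "par a < a" using par[of a] less.prems by auto
      then show ?thesis
        using less.IH[of "par a"] up[OF a(1) less.prems] less.prems
        by (auto intro: H.adj_reachable_trans H.reachable_adj_trans)
    qed
  qed
  show "parcs G \<subseteq> tree_arcs n par f"
  proof (rule subrelI, rule ccontr)
    fix x y assume xy: "(x, y) \<in> parcs G" "(x, y) \<notin> tree_arcs n par f"
    have "x \<in> f ` {..n}" "y \<in> f ` {..n}" using f in_arcsD1[OF xy(1)] in_arcsD2[OF xy(1)] by auto
    then have "reachable (with_proj H) y x" using root H.reachable_trans by blast
    then obtain p where p: "H.apath y p x" using H.reachable_apath by blast
    then have "set p \<subseteq> parcs H" and cas: "pcas y p x" and dist: "distinct (pawalk_verts y p)"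
      by (simp_all add: H.apath_def H.awalk_def)
    then have set: "set p \<subseteq> tree_arcs n par f" by (simp add: H_def)
    have walk: "awalk y p x" using set cas sub in_arcsD2[OF xy(1)] by (auto simp: awalk_def)
    have "x \<noteq> y" using no_loops'[OF xy(1)] .
    have "2 \<le> length p"
    proof (rule ccontr)
      assume "\<not> 2 \<le> length p"
      then consider "p = []" | e where "p = [e]" by (cases p; cases "tl p") auto
      then show False
      proof cases
        case 1
        then show False using cas \<open>x \<noteq> y\<close> by simp
      next
        case 2
        then have "(y, x) \<in> tree_arcs n par f" using cas set by (cases e) auto
        then show False using xy(2) by (auto simp: tree_arcs_def Let_def)
      qed
    qed
    moreover have "cycle ((x, y) # p)"
      unfolding cycle_def using walk xy(1) dist in_arcsD1[OF xy(1)]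
      by (intro exI[of _ x]) (auto simp: awalk_Cons_iff)
    ultimately show False using acyclic by (metis length_Cons numeral_3_eq_3 numeral_2_eq_2 Suc_le_mono)
  qed
qed

end

lemma undirected_tree_numbering:
  assumes "undirected_tree T"
  obtains n f par where "inj_on f {..n}" "pverts T = f ` {..n}"
    "\<And>a. 0 < a \<Longrightarrow> a \<le> n \<Longrightarrow> par a < a" "parcs T = tree_arcs n par f"
proof -
  interpret pair_graph T using assms by (simp add: undirected_tree_def)
  have conn: "Digraph_Component.connected (with_proj T)"
    using assms by (simp add: undirected_tree_def)
  then have "pverts T \<noteq> {}" by (auto simp: connected_def strongly_connected_def)
  then have pos: "0 < card (pverts T)" using pair_finite_verts by (simp add: card_gt_0_iff)
  define n where "n = card (pverts T) - 1"
  obtain f par where f: "inj_on f {..n}" "f ` {..n} \<subseteq> pverts T"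
    and par: "\<And>a. 0 < a \<Longrightarrow> a \<le> n \<Longrightarrow> par a < a \<and> (f a, f (par a)) \<in> parcs T"
    using numbering[OF conn, of n] pos by (auto simp: n_def)
  have "card (f ` {..n}) = card (pverts T)" using f(1) pos by (simp add: card_image n_def)
  then have eq: "f ` {..n} = pverts T" using f(2) pair_finite_verts card_subset_eq by blast
  have "parcs T = tree_arcs n par f"
    using tree_arcs_eq_if_acyclic[OF _ eq par] assms by (simp add: undirected_tree_def)
  then show thesis using that[OF f(1) eq[symmetric]] par by blast
qed

lemma map_prod_tree_arcs:
  "map_prod g g ` tree_arcs n par f = tree_arcs n par (\<lambda>a. g (f a))"
proof -
  have "map_prod g g ` {(f a, f (par a)) | a. 0 < a \<and> a \<le> n} = {(g (f a), g (f (par a))) | a. 0 < a \<and> a \<le> n}"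
    by force
  moreover have "map_prod g g ` (U\<inverse>) = (map_prod g g ` U)\<inverse>" for U by force
  ultimately show ?thesis by (simp add: tree_arcs_def Let_def image_Un)
qed

lemma pair_bidirected_copy_graph:
  assumes "pair_graph T" shows "pair_bidirected_digraph (copy_graph T)"
proof -
  interpret pair_graph T by fact
  show ?thesis
  proof
    show "fst e \<in> pverts (copy_graph T)" "snd e \<in> pverts (copy_graph T)"
      if "e \<in> parcs (copy_graph T)" for e
      using that in_arcsD1 in_arcsD2 by (auto simp: copy_graph_def)
    show "symmetric (with_proj (copy_graph T))"
      using arc_sym by (force simp: symmetric_def sym_def copy_graph_def)
    show "fst e \<noteq> snd e" if "e \<in> parcs (copy_graph T)" for e
      using that no_loops' by (auto simp: copy_graph_def)
  qed
qed

section \<open>The long-legged graph as an iterated subdivision\<close>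

definition node :: "(nat \<Rightarrow> 'a) \<Rightarrow> nat \<times> nat \<Rightarrow> 'a + nat" where
  "node f = (\<lambda>(a, i). if i = 0 then Inl (f a) else Inr (prod_encode (a, i)))"

definition subdivided ::
    "nat \<Rightarrow> (nat \<Rightarrow> nat) \<Rightarrow> (nat \<Rightarrow> 'a) \<Rightarrow> (nat \<Rightarrow> nat) \<Rightarrow> ('a + nat) pair_pre_digraph" where
  "subdivided n par f K = \<lparr>pverts = node f ` path_verts n K,
     parcs = map_prod (node f) (node f) ` path_edges n par K\<rparr>"

lemma inj_on_node: "inj_on f {..n} \<Longrightarrow> inj_on (node f) ({..n} \<times> UNIV)"
  by (auto simp: inj_on_def node_def split: if_splits)

context rooted_tree
begin

lemma path_verts_extend:
  assumes "0 < a" "a \<le> n"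
  shows "path_verts n (L(a := Suc (L a))) = insert (a, L a) (path_verts n L)"
  using assms by (auto simp: path_verts_def less_Suc_eq split: if_splits)

text \<open>Always dividing the edge next to the parent leaves the coordinates of all existing
  vertices unchanged.\<close>

lemma path_edges_extend:
  assumes a: "0 < a" "a \<le> n" "0 < L a"
  defines "x \<equiv> (a, L a - 1)" and "y \<equiv> (par a, 0)" and "w \<equiv> (a, L a)"
  shows "path_edges n par (L(a := Suc (L a))) =
    path_edges n par L - {(x, y), (y, x)} \<union> {(x, w), (w, x), (w, y), (y, w)}"
    and "(x, y) \<in> path_edges n par L"
proof -
  define U where "U L = {(x, path_up par L x) | x. x \<in> path_verts n L \<and> 0 < fst x}" for L
  let ?L = "L(a := Suc (L a))"
  have edges: "path_edges n par L = U L \<union> (U L)\<inverse>" for L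
    by (simp add: path_edges_def U_def Let_def)
  have x: "x \<in> path_verts n L" "0 < fst x" "path_up par L x = y"
    using a by (auto simp: x_def y_def path_verts_def path_up_def)
  show "(x, y) \<in> path_edges n par L"
    unfolding edges U_def using x by blast
  have up: "path_up par ?L z = path_up par L z" if "z \<in> path_verts n L" "0 < fst z" "z \<noteq> x" for z
    using that by (cases z) (auto simp: path_up_def path_verts_def x_def)
  have upx: "path_up par ?L x = w" "path_up par ?L w = y"
    using a by (auto simp: path_up_def x_def w_def y_def)
  have verts: "path_verts n ?L = insert w (path_verts n L)" and w: "w \<notin> path_verts n L" "0 < fst w"
    using path_verts_extend[OF a(1,2), of L] a by (auto simp: w_def path_verts_def)
  have eq: "U ?L = (U L - {(x, y)}) \<union> {(x, w), (w, y)}"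
  proof (rule set_eqI)
    fix e :: "(nat \<times> nat) \<times> nat \<times> nat"
    obtain z z' where e: "e = (z, z')" by (cases e)
    have U: "e \<in> U L \<longleftrightarrow> z \<in> path_verts n L \<and> 0 < fst z \<and> z' = path_up par L z" for L
      unfolding U_def e by blast
    have "w \<noteq> x" using w x by auto
    show "e \<in> U ?L \<longleftrightarrow> e \<in> (U L - {(x, y)}) \<union> {(x, w), (w, y)}"
    proof (cases "z = x \<or> z = w")
      case True
      then show ?thesis using U[of ?L] U[of L] x w upx verts \<open>w \<noteq> x\<close> e by auto
    next
      case False
      then show ?thesis using U[of ?L] U[of L] up[of z] verts e by auto
    qed
  qed
  \<comment> \<open>Going up never increases the first component and \<open>par a < a\<close>, so
    \<open>U L\<close> contains the divided edge in one orientation only.\<close>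
  have "(y, x) \<notin> U L"
  proof
    assume "(y, x) \<in> U L"
    then have y: "0 < par a" "y \<in> path_verts n L" "x = path_up par L y" by (auto simp: U_def y_def)
    then have "fst x \<le> par a"
      using par_less[of "par a"] par_less[OF a(1,2)] a(2) by (auto simp: path_up_def y_def split: if_splits)
    then show False using par_less[OF a(1,2)] by (simp add: x_def)
  qed
  moreover have "x \<noteq> y" using par_less[OF a(1,2)] by (simp add: x_def y_def)
  ultimately show "path_edges n par ?L =
    path_edges n par L - {(x, y), (y, x)} \<union> {(x, w), (w, x), (w, y), (y, w)}"
    unfolding edges eq by auto
qed

lemma path_edges_subset:
  "path_edges n par L \<subseteq> ({..n} \<times> UNIV) \<times> ({..n} \<times> UNIV)"
proof -
  have "fst x \<le> n" if "x \<in> path_verts n L" for x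
    using that by (auto simp: path_verts_def)
  moreover have "fst (path_up par L x) \<le> n" if "x \<in> path_verts n L" "0 < fst x" for x
  proof -
    obtain a i where x: "x = (a, i)" by (cases x)
    then have "0 < a" "a \<le> n" using that by (auto simp: path_verts_def)
    then have "par a < a" "a \<le> n" using par_less by auto
    then show ?thesis by (simp add: x path_up_def)
  qed
  ultimately have up: "x \<in> {..n} \<times> UNIV" "path_up par L x \<in> {..n} \<times> UNIV"
    if "x \<in> path_verts n L" "0 < fst x" for x
    using that by (auto simp: mem_Times_iff)
  show ?thesis
  proof
    fix e assume "e \<in> path_edges n par L"
    then obtain x where "x \<in> path_verts n L" "0 < fst x" "e = (x, path_up par L x) \<or> e = (path_up par L x, x)"
      unfolding path_edges_def Let_def by blast
    then show "e \<in> ({..n} \<times> UNIV) \<times> ({..n} \<times> UNIV)" using up[of x] by blast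
  qed
qed

lemma subdivided_extend:
  assumes a: "0 < a" "a \<le> n" "0 < L a"
    and f: "inj_on f {..n}"
  shows "subdivided n par f (L(a := Suc (L a))) =
    subdivide (subdivided n par f L) (node f (a, L a - 1), node f (par a, 0)) (node f (a, L a))"
proof -
  let ?D = "{..n} \<times> (UNIV :: nat set)"
  let ?x = "(a, L a - 1)" and ?y = "(par a, 0 :: nat)" and ?w = "(a, L a)"
  let ?N = "map_prod (node f) (node f)"
  have inj: "inj_on ?N (?D \<times> ?D)"
    using inj_on_node[OF f] by (intro map_prod_inj_on)
  have xy: "?x \<in> ?D" "?y \<in> ?D" using a par_less[OF a(1,2)] by auto
  have "?N ` (path_edges n par L - {(?x, ?y), (?y, ?x)}) =
      ?N ` path_edges n par L - ?N ` {(?x, ?y), (?y, ?x)}"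
    by (rule inj_on_image_set_diff[OF inj]) (use path_edges_subset xy in auto)
  then show ?thesis
    unfolding subdivided_def subdivide.simps path_edges_extend(1)[where a = a and L = L, OF a] path_verts_extend[OF a(1,2)]
    by (simp add: image_Un)
qed

text \<open>Induction on the total length: one path is shortened by one vertex, and with all lengths
  1 the graph is the copy of \<open>T\<close>.\<close>

lemma is_subdivision_of_subdivided:
  assumes T: "pair_graph T" "pverts T = f ` {..n}" "parcs T = tree_arcs n par f"
    and f: "inj_on f {..n}"
    and L: "\<And>a. 0 < L a"
  shows "is_subdivision_of (subdivided n par f L) T"
  using L
proof (induction "\<Sum>a = 1..n. L a" arbitrary: L rule: less_induct)
  case less
  show ?case
  proof (cases "\<exists>a. 0 < a \<and> a \<le> n \<and> L a \<noteq> 1")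
    case True
    then obtain a where a: "0 < a" "a \<le> n" "L a \<noteq> 1" by blast
    then have La: "1 < L a" using less.prems[of a] by simp
    define L' where "L' = L(a := L a - 1)"
    have L': "0 < L' b" for b using less.prems[of b] La by (simp add: L'_def)
    have LL': "L = L'(a := Suc (L' a))" using La by (simp add: L'_def)
    have "(\<Sum>b = 1..n. L' b) < (\<Sum>b = 1..n. L b)"
      using a La by (intro sum_strict_mono_ex1) (auto simp: L'_def)
    then have sd: "subdivision_pair (copy_graph T) (subdivided n par f L')"
      using less.hyps[of L'] L' by (simp add: is_subdivision_of_def)
    have "(node f (a, L' a - 1), node f (par a, 0)) \<in> parcs (subdivided n par f L')"
      using path_edges_extend(2)[where a = a and L = L', OF a(1,2) L']
      by (force simp: subdivided_def)
    moreover have "node f (a, L' a) \<notin> pverts (subdivided n par f L')"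
      using L'[of a] by (auto simp: subdivided_def node_def path_verts_def split: if_splits)
    ultimately have "subdivision_pair (copy_graph T)
        (subdivide (subdivided n par f L') (node f (a, L' a - 1), node f (par a, 0)) (node f (a, L' a)))"
      using sd by (rule subdivision_pair_divide)
    then show ?thesis
      using subdivided_extend[where a = a and L = L', OF a(1,2) L' f]
      unfolding LL'[symmetric] is_subdivision_of_def by simp
  next
    case False
    then have K1: "L a = 1" if "0 < a" "a \<le> n" for a using that by blast
    have verts: "path_verts n L = {..n} \<times> {0}"
      using K1 by (auto simp: path_verts_def)
    have edges: "path_edges n par L = tree_arcs n par (\<lambda>a. (a, 0))"
      unfolding path_edges_def tree_arcs_def verts path_up_def using K1 by (auto simp: Let_def)
    have "map_prod (node f) (node f) ` path_edges n par L = map_prod Inl Inl ` parcs T"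
      unfolding edges T(3) map_prod_tree_arcs by (simp add: node_def)
    then have "subdivided n par f L = copy_graph T"
      by (force simp: subdivided_def copy_graph_def verts T(2) image_iff node_def)
    then show ?thesis
      using pair_bidirected_copy_graph[OF T(1)] by (simp add: is_subdivision_of_def subdivision_pair_base)
  qed
qed

end

theorem theorem15:
  fixes T :: "'a pair_pre_digraph" and k :: nat
  assumes "undirected_tree T" and "k > 1"
  shows "\<exists>T' :: ('a + nat) pair_pre_digraph.
           is_subdivision_of T' T \<and> visibility_localization_number k T' = 1"
proof -
  obtain n f par where T: "inj_on f {..n}" "pverts T = f ` {..n}"
    "\<And>a. 0 < a \<Longrightarrow> a \<le> n \<Longrightarrow> par a < a" "parcs T = tree_arcs n par f"
    using undirected_tree_numbering[OF assms(1)] by metis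
  interpret rooted_tree n par using T(3) by unfold_locales
  have T_graph: "pair_graph T" using assms(1) by (simp add: undirected_tree_def)
  let ?T = "subdivided n par f K"
  have sd: "is_subdivision_of ?T T"
    by (rule is_subdivision_of_subdivided[OF T_graph T(2,4,1) K_pos])
  interpret T': pair_wf_digraph ?T
  proof -
    have "pair_bidirected_digraph ?T"
      using sd unfolding is_subdivision_of_def by (rule bidirected_digraphI_subdivision)
    then show "pair_wf_digraph ?T"
      by (simp add: pair_bidirected_digraph_def pair_sym_digraph_def)
  qed
  have "V \<subseteq> {..n} \<times> UNIV" by (auto simp: V_def path_verts_def)
  then have "inj_on (node f) V" using inj_on_node[OF T(1)] inj_on_subset by blast
  then have "winning (pverts ?T) (parcs ?T) (pverts ?T)"
    using winning_image[OF winning_path_tree, of "node f"] E_V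
    by (simp add: subdivided_def V_def E_def)
  then have "cops_win k ?T 1"
    using assms(2) by (intro T'.cops_win_if_winning) auto
  then have "visibility_localization_number k ?T = 1"
    unfolding visibility_localization_number_def by (intro Least_equality) auto
  then show ?thesis using sd by blast
qed

end
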